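(* Let $\mathbb{K}$ be an algebraically closed field of characteristic $0$ and let $n\ge3$. In $\mathbb{K}[x_0,\dots,x_n]$: (1) $F_1=x_0^2(x_0^2+\cdots+x_n^2)$ has $\mathrm{srk}(F_1)=3n$. (2) $F_2=x_0^2(x_1^2+\cdots+x_n^2)$ has $\mathrm{srk}(F_2)=3n$. (3) $F_3=x_0^2(x_0x_1+x_2^2+\cdots+x_n^2)$ has $\mathrm{srk}(F_3)=3n+1$. (4) $F_4=x_0x_1(x_2^2+\cdots+x_n^2)$ has $\mathrm{srk}(F_4)=4(n-1)$. (5) $F_5=x_0x_1(x_1x_2+x_3^2+\cdots+x_n^2)$ satisfies $4(n-1)\le\mathrm{srk}(F_5)\le4(n-1)+2$. (6) $F_6=x_0x_1(x_1^2+\cdots+x_n^2)$ has $\mathrm{srk}(F_6)=4(n-1)$. (7) $F_7=x_0(x_0+x_1)(x_1^2+\cdots+x_n^2)$ satisfies $4(n-1)\le\mathrm{srk}(F_7)\le4(n-1)+2$. (8) $F_{8,\lambda}=x_0(\lambda x_0+x_1)(x_0^2+\cdots+x_n^2)$ satisfies $4(n-1)\le\mathrm{srk}(F_{8,\lambda})\le4(n-1)+2$ for every $0\ne\lambda\in\mathbb{K}$, and $F_{8,0}=x_0x_1(x_0^2+x_1^2+\cdots+x_n^2)$ has $\mathrm{srk}(F_{8,0})=4(n-1)$. (9) $F_9=x_0x_1(x_0^2+x_1x_2+x_3^2+\cdots+x_n^2)$ satisfies $4(n-1)\le\mathrm{srk}(F_9)\le4(n-1)+2$. (10) $F_{10,\lambda}=x_0(-\lambda^2x_0+x_1+\lambda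 x_2)(x_0x_1+x_2^2+\cdots+x_n^2)$ satisfies $4(n-1)\le\mathrm{srk}(F_{10,\lambda})\le4(n-1)+2$ for every $\lambda\in\mathbb{K}$. Moreover, each of $F_4$, $F_6$ and $F_{8,0}$ admits infinitely many symmetric decompositions of length $4(n-1)$.
   Context: For a form $F\in R=\mathbb{K}[x_0,\dots,x_n]$ of degree $d$, a symmetric (Waring) decomposition of $F$ of length $r$ is a set of $r$ linear forms $\{m_1,\dots,m_r\}\subset R_1$ with $F\in\langle m_1^d,\dots,m_r^d\rangle$; decompositions are considered as sets of points $[m_i]\in\mathbb{P}(R_1)$, i.e. up to rescaling the linear forms. The symmetric rank $\mathrm{srk}(F)$ is the minimal length of a symmetric decomposition of $F$. *)

theory Defs
  imports
    "HOL-Library.Poly_Mapping"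
    "HOL-Library.Extended_Nat"
    "HOL-Computational_Algebra.Polynomial"
begin

text \<open>
  Multivariate polynomials in the variables $x_0, x_1, \dots$: finitely supported maps from
  monomials (finitely supported exponent vectors) to coefficients, with the convolution product
  of \<^theory>\<open>HOL-Library.Poly_Mapping\<close>. The ring $K[x_0,\dots,x_n]$ is the subring of
  polynomials in the variables of index at most $n$; the linear forms below are restricted
  accordingly.
\<close>
type_synonym 'k mpol = "(nat \<Rightarrow>\<^sub>0 nat) \<Rightarrow>\<^sub>0 'k"

definition Var :: "nat \<Rightarrow> 'k::comm_ring_1 mpol"
  where "Var i = Poly_Mapping.single (Poly_Mapping.single i 1) 1"

definition scale :: "'k::comm_ring_1 \<Rightarrow> 'k mpol \<Rightarrow> 'k mpol"
  where "scale c p = Poly_Mapping.single 0 c * p"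

global_interpretation mpol: vector_space "scale :: 'k::field \<Rightarrow> 'k mpol \<Rightarrow> 'k mpol"
proof
  fix a b :: 'k and p q :: "'k mpol"
  show "scale a (p + q) = scale a p + scale a q"
    by (simp add: scale_def distrib_left)
  show "scale (a + b) p = scale a p + scale b p"
    by (simp add: scale_def single_add distrib_right)
  show "scale a (scale b p) = scale (a * b) p"
    by (simp add: scale_def mult_single flip: mult.assoc)
  show "scale 1 p = p"
    by (simp add: scale_def)
qed

text \<open>The space $R_1$ of linear forms of $R = K[x_0,\dots,x_n]$.\<close>
definition linear_forms :: "nat \<Rightarrow> 'k::field mpol set"
  where "linear_forms n = mpol.span (Var ` {..n})"

text \<open>The point $[m]$, represented by the set of all nonzero multiples of $m$.\<close>
definition proj_point :: "'k::field mpol \<Rightarrow> 'k mpol set"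
  where "proj_point m = {scale c m | c. c \<noteq> 0}"

definition proj_linear_forms :: "nat \<Rightarrow> 'k::field mpol set set"
  where "proj_linear_forms n = proj_point ` (linear_forms n - {0})"

text \<open>
  A symmetric decomposition of a form \<open>F\<close> of degree \<open>d\<close> is a finite set \<open>Z\<close> of points of
  $\mathbf{P}(R_1)$; its length is \<open>card Z\<close>. The set \<open>M\<close> contains one linear form for each point
  of \<open>Z\<close>; the span of the powers does not depend on this choice.
\<close>
definition symmetric_decomposition ::
    "nat \<Rightarrow> nat \<Rightarrow> 'k::field mpol \<Rightarrow> 'k mpol set set \<Rightarrow> bool"
  where "symmetric_decomposition n d F Z \<longleftrightarrow>
    finite Z \<and> Z \<subseteq> proj_linear_forms n \<and>
    (\<exists>M. M \<subseteq> linear_forms n - {0} \<and> bij_betw proj_point M Z \<and>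
         F \<in> mpol.span ((\<lambda>m. m ^ d) ` M))"

text \<open>
  The value is \<open>\<infinity>\<close> if there is no decomposition, so that a finite value or upper bound
  includes the existence of one.
\<close>
definition srk :: "nat \<Rightarrow> nat \<Rightarrow> 'k::field mpol \<Rightarrow> enat"
  where "srk n d F = (INF Z \<in> {Z. symmetric_decomposition n d F Z}. enat (card Z))"

end

theory Submission
  imports Defs "HOL-Library.Function_Algebras"
begin

text \<open>
  Lower bounds. For a decomposition \<open>F = \<Sum> c\<^sub>m m\<^sup>d\<close> of a form, differentiating \<open>F\<close> evaluates the
  functional \<open>f \<mapsto> \<Sum> c\<^sub>m f m\<close> on forms \<open>f\<close> of degree \<open>d\<close>, where the points \<open>m\<close> are viewed in the dual
  coordinates. All quartics below have the shape \<open>g (h z + \<Sum> y\<^sub>a\<^sup>2) + \<dots>\<close> with \<open>g\<close> a product of two linear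
  forms. Discard the points on the linear space on which all coordinates \<open>y\<^sub>a\<close> and \<open>z\<close> vanish. On the
  remaining ones, multiplication by \<open>z\<close> off the hyperplane \<open>z = 0\<close>, and by a generic combination of
  the \<open>y\<^sub>a\<close> on it, embeds the functions given by forms of degree \<open>j - 1\<close> into those of degree \<open>j\<close>, and
  suitable derivatives of \<open>F\<close> vanish on the image. Counting these derivatives for \<open>j < d\<close> bounds the
  number of points from below.

  Upper bounds. For linear forms \<open>a\<close>, \<open>b\<close>, \<open>y\<close> the four forms \<open>p a \<plusminus> q b \<plusminus> y\<close> decompose
  \<open>a b (y\<^sup>2 + p\<^sup>2 a\<^sup>2 / 3 + q\<^sup>2 b\<^sup>2 / 3)\<close>. In a sum over at least two forms \<open>y\<^sub>i\<close> the sums of the \<open>p\<^sub>i\<^sup>2\<close> and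
  of the \<open>q\<^sub>i\<^sup>2\<close> can be prescribed, in infinitely many ways. Similarly three forms decompose
  \<open>a\<^sup>2 (y\<^sup>2 + s a\<^sup>2)\<close>. The remaining binary and ternary quartics need few further forms.
\<close>

section \<open>Directional derivatives of polynomials\<close>

text \<open>The function \<open>v\<close> lists the coordinates of the direction. Truncated
  subtraction of exponents is applied only to variables that occur, so it is genuine.\<close>

definition monom_dderiv :: "(nat \<Rightarrow> 'k::comm_ring_1) \<Rightarrow> (nat \<Rightarrow>\<^sub>0 nat) \<Rightarrow> 'k mpol"
  where "monom_dderiv v \<alpha> =
    (\<Sum>i\<in>Poly_Mapping.keys \<alpha>. Poly_Mapping.single (\<alpha> - Poly_Mapping.single i 1) (of_nat (Poly_Mapping.lookup \<alpha> i) * v i))"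

definition dderiv :: "(nat \<Rightarrow> 'k::comm_ring_1) \<Rightarrow> 'k mpol \<Rightarrow> 'k mpol"
  where "dderiv v p = (\<Sum>\<alpha>\<in>Poly_Mapping.keys p. scale (Poly_Mapping.lookup p \<alpha>) (monom_dderiv v \<alpha>))"

lemma monom_dderiv_superset:
  assumes "finite S" "Poly_Mapping.keys \<alpha> \<subseteq> S"
  shows "monom_dderiv v \<alpha> =
    (\<Sum>i\<in>S. Poly_Mapping.single (\<alpha> - Poly_Mapping.single i 1) (of_nat (Poly_Mapping.lookup \<alpha> i) * v i))"
  unfolding monom_dderiv_def
  by (rule sum.mono_neutral_left) (use assms in \<open>auto simp: in_keys_iff\<close>)

lemma dderiv_superset:
  assumes "finite S" "Poly_Mapping.keys p \<subseteq> S"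
  shows "dderiv v p = (\<Sum>\<alpha>\<in>S. scale (Poly_Mapping.lookup p \<alpha>) (monom_dderiv v \<alpha>))"
  unfolding dderiv_def
  by (rule sum.mono_neutral_left) (use assms in \<open>auto simp: in_keys_iff scale_def\<close>)

lemma monom_dderiv_add:
  "monom_dderiv v (\<alpha> + \<beta>) =
    Poly_Mapping.single \<alpha> 1 * monom_dderiv v \<beta> + Poly_Mapping.single \<beta> 1 * monom_dderiv v \<alpha>"
proof -
  define S where "S = Poly_Mapping.keys \<alpha> \<union> Poly_Mapping.keys \<beta>"
  have fin: "finite S" by (simp add: S_def)
  \<comment> \<open>If \<open>i\<close> does not occur in \<open>\<gamma>\<close>, both coefficients
    are 0, whatever the truncated subtraction gives. Otherwise the subtraction commutes with adding
    \<open>\<delta>\<close>.\<close>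
  have split: "Poly_Mapping.single (\<gamma> + \<delta> - Poly_Mapping.single i 1) (of_nat (Poly_Mapping.lookup \<gamma> i) * v i) =
      Poly_Mapping.single \<delta> 1 *
        Poly_Mapping.single (\<gamma> - Poly_Mapping.single i 1) (of_nat (Poly_Mapping.lookup \<gamma> i) * v i)"
    for \<gamma> \<delta> :: "nat \<Rightarrow>\<^sub>0 nat" and i
  proof (cases "Poly_Mapping.lookup \<gamma> i = 0")
    case False
    then have "\<gamma> + \<delta> - Poly_Mapping.single i 1 = \<delta> + (\<gamma> - Poly_Mapping.single i 1)"
      by (intro poly_mapping_eqI) (auto simp: lookup_add lookup_minus lookup_single when_def)
    then show ?thesis
      by (simp add: mult_single)
  qed simp
  have "monom_dderiv v (\<alpha> + \<beta>) = (\<Sum>i\<in>S.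
      Poly_Mapping.single (\<alpha> + \<beta> - Poly_Mapping.single i 1) (of_nat (Poly_Mapping.lookup \<alpha> i) * v i) +
      Poly_Mapping.single (\<alpha> + \<beta> - Poly_Mapping.single i 1) (of_nat (Poly_Mapping.lookup \<beta> i) * v i))"
    by (subst monom_dderiv_superset[of S])
      (use fin in \<open>auto simp: S_def lookup_add single_add distrib_right
        dest: subsetD[OF keys_add]\<close>)
  also have "\<dots> = Poly_Mapping.single \<beta> 1 * monom_dderiv v \<alpha> + Poly_Mapping.single \<alpha> 1 * monom_dderiv v \<beta>"
    using split[of \<alpha> \<beta>] split[of \<beta> \<alpha>]
    by (subst (1 2) monom_dderiv_superset[of S])
      (use fin in \<open>auto simp: S_def sum.distrib sum_distrib_left add.commute\<close>)
  finally show ?thesis by (simp add: add.commute)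
qed

lemma dderiv_add: "dderiv v (p + q) = dderiv v p + dderiv v q"
proof -
  let ?S = "Poly_Mapping.keys p \<union> Poly_Mapping.keys q"
  show ?thesis
    using keys_add[of p q]
    by (subst (1 2 3) dderiv_superset[of ?S])
      (auto simp: lookup_add scale_def single_add distrib_right sum.distrib)
qed

lemma dderiv_0 [simp]: "dderiv v 0 = 0"
  by (simp add: dderiv_def)

lemma dderiv_single: "dderiv v (Poly_Mapping.single \<alpha> c) = scale c (monom_dderiv v \<alpha>)"
  by (simp add: dderiv_def scale_def)

lemma mpol_expansion:
  "p = (\<Sum>\<alpha>\<in>Poly_Mapping.keys p. Poly_Mapping.single \<alpha> (Poly_Mapping.lookup p \<alpha>))"
  by (intro poly_mapping_eqI)
    (auto simp: lookup_sum lookup_single when_def in_keys_iff)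

lemma dderiv_sum: "dderiv v (\<Sum>i\<in>S. f i) = (\<Sum>i\<in>S. dderiv v (f i))"
  by (induction S rule: infinite_finite_induct) (auto simp: dderiv_add)

text \<open>Both sides are biadditive, so the Leibniz rule follows from its case for
  monomials.\<close>

lemma dderiv_mult: "dderiv v (p * q) = p * dderiv v q + q * dderiv v p"
proof -
  have mono: "dderiv v (Poly_Mapping.single \<alpha> c * Poly_Mapping.single \<beta> d) =
      Poly_Mapping.single \<alpha> c * dderiv v (Poly_Mapping.single \<beta> d) +
      Poly_Mapping.single \<beta> d * dderiv v (Poly_Mapping.single \<alpha> c)" for \<alpha> \<beta> and c d :: 'a
  proof -
    have eq: "scale (c * d) (Poly_Mapping.single \<gamma> 1 * P) = Poly_Mapping.single \<gamma> c * scale d P"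
      for c d and \<gamma> :: "nat \<Rightarrow>\<^sub>0 nat" and P :: "'a mpol"
      by (simp add: scale_def mult_single flip: mult.assoc)
    have "dderiv v (Poly_Mapping.single \<alpha> c * Poly_Mapping.single \<beta> d) =
        scale (c * d) (Poly_Mapping.single \<alpha> 1 * monom_dderiv v \<beta>) +
        scale (d * c) (Poly_Mapping.single \<beta> 1 * monom_dderiv v \<alpha>)"
      by (simp add: mult_single dderiv_single monom_dderiv_add scale_def distrib_left mult.commute)
    also have "\<dots> = Poly_Mapping.single \<alpha> c * dderiv v (Poly_Mapping.single \<beta> d) +
        Poly_Mapping.single \<beta> d * dderiv v (Poly_Mapping.single \<alpha> c)"
      by (simp only: eq dderiv_single)
    finally show ?thesis .
  qed
  have "dderiv v ((\<Sum>\<alpha>\<in>S. Poly_Mapping.single \<alpha> (f \<alpha>)) * (\<Sum>\<beta>\<in>T. Poly_Mapping.single \<beta> (g \<beta>))) =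
      (\<Sum>\<alpha>\<in>S. Poly_Mapping.single \<alpha> (f \<alpha>)) * dderiv v (\<Sum>\<beta>\<in>T. Poly_Mapping.single \<beta> (g \<beta>)) +
      (\<Sum>\<beta>\<in>T. Poly_Mapping.single \<beta> (g \<beta>)) * dderiv v (\<Sum>\<alpha>\<in>S. Poly_Mapping.single \<alpha> (f \<alpha>))"
    for S T and f g :: "(nat \<Rightarrow>\<^sub>0 nat) \<Rightarrow> 'a"
    by (simp add: dderiv_sum sum_product mono sum.distrib)
      (rule sum.swap)
  from this[of "Poly_Mapping.lookup p" "Poly_Mapping.keys p" "Poly_Mapping.lookup q" "Poly_Mapping.keys q"]
  show ?thesis
    by (simp flip: mpol_expansion)
qed

lemma dderiv_scale: "dderiv v (scale c p) = scale c (dderiv v p)"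
proof -
  have "dderiv v (Poly_Mapping.single 0 c) = 0"
    by (simp add: dderiv_single monom_dderiv_def scale_def)
  then show ?thesis
    unfolding scale_def by (simp add: dderiv_mult)
qed

lemma dderiv_Var: "dderiv v (Var i) = Poly_Mapping.single 0 (v i)"
  by (simp add: Var_def dderiv_single monom_dderiv_def scale_def)

lemma dderiv_const [simp]: "dderiv v (Poly_Mapping.single 0 c) = 0"
  by (simp add: dderiv_single monom_dderiv_def scale_def)

lemma dderiv_power: "dderiv v (p ^ Suc k) = of_nat (Suc k) * p ^ k * dderiv v p"
  by (induction k) (simp_all add: dderiv_mult algebra_simps)

section \<open>Dimensions of spaces of functions\<close>

interpretation fun_vs: vector_space "\<lambda>c (f :: 'p \<Rightarrow> 'k::field) x. c * f x"
  by standard (auto simp: fun_eq_iff algebra_simps)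

lemma sum_fun_apply: "(\<Sum>i\<in>I. f i) x = (\<Sum>i\<in>I. f i x)"
  for f :: "'i \<Rightarrow> 'p \<Rightarrow> 'k::comm_monoid_add"
  by (induction I rule: infinite_finite_induct) auto

text \<open>Independence of a family excludes repetitions: two equal members would satisfy the
  relation with coefficients 1 and -1. Hence the index set itself can be counted.\<close>

lemma (in vector_space) indexed_independent_card_le:
  assumes fin: "finite T" "finite I" and sub: "g ` I \<subseteq> span T"
    and indep: "\<And>c. (\<Sum>i\<in>I. c i *s g i) = 0 \<Longrightarrow> \<forall>i\<in>I. c i = 0"
  shows "card I \<le> card T"
proof -
  have inj: "inj_on g I"
  proof (rule inj_onI, rule ccontr)
    fix i j assume ij: "i \<in> I" "j \<in> I" "g i = g j" "i \<noteq> j"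
    have "(\<Sum>k\<in>I. (if k = i then 1 else if k = j then - 1 else 0) *s g k) =
        (\<Sum>k\<in>I. (if k = i then g k else 0) - (if k = j then g k else 0))"
      using ij by (intro sum.cong) auto
    also have "\<dots> = 0"
      using fin ij by (simp add: sum_subtractf)
    finally show False
      using indep[of "\<lambda>k. if k = i then 1 else if k = j then - 1 else 0"] ij by auto
  qed
  have "independent (g ` I)"
  proof
    assume "dependent (g ` I)"
    then obtain u where u: "(\<Sum>v\<in>g ` I. u v *s v) = 0" "\<exists>v\<in>g ` I. u v \<noteq> 0"
      using fin by (subst (asm) dependent_finite) auto
    then show False
      using indep[of "u \<circ> g"] by (simp add: sum.reindex[OF inj])
  qed
  then have "card (g ` I) \<le> card T"
    using independent_span_bound[OF fin(1)] sub by blast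
  then show ?thesis
    by (simp add: card_image inj)
qed

text \<open>Indicator functions of points suffice. This is what turns a dimension estimate into an
  estimate of the number of points.\<close>

lemma fun_finite_support_span:
  fixes f :: "'p \<Rightarrow> 'k::field"
  assumes "finite X" "\<And>x. x \<notin> X \<Longrightarrow> f x = 0"
  shows "f \<in> fun_vs.span ((\<lambda>x y. if y = x then 1 else 0) ` X)"
proof -
  have "f = (\<Sum>x\<in>X. (\<lambda>y. f x * (if y = x then 1 else 0)))"
    using assms
    by (intro ext) (auto simp: sum_fun_apply if_distrib cong: if_cong)
  also have "\<dots> \<in> fun_vs.span ((\<lambda>x y. if y = x then 1 else 0) ` X)"
    by (intro fun_vs.span_sum fun_vs.span_scale fun_vs.span_base) auto
  finally show ?thesis .
qed

lemma fun_independent_finite: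
  fixes B :: "('p \<Rightarrow> 'k::field) set"
  assumes "finite X" "fun_vs.independent B" "\<And>f x. f \<in> B \<Longrightarrow> x \<notin> X \<Longrightarrow> f x = 0"
  shows "finite B" "card B \<le> card X"
proof -
  have "finite B \<and> card B \<le> card ((\<lambda>x y. if y = x then (1::'k) else 0) ` X)"
    by (rule fun_vs.independent_span_bound)
      (use assms in \<open>auto intro: fun_finite_support_span\<close>)
  then show "finite B" "card B \<le> card X"
    using card_image_le[OF assms(1), of "\<lambda>x y. if y = x then (1::'k) else 0"] by auto
qed

lemma fun_dim_le_card:
  fixes E :: "('p \<Rightarrow> 'k::field) set"
  assumes "finite X" "\<And>f x. f \<in> E \<Longrightarrow> x \<notin> X \<Longrightarrow> f x = 0"
  shows "fun_vs.dim E \<le> card X"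
proof -
  obtain B where B: "B \<subseteq> E" "fun_vs.independent B" "E \<subseteq> fun_vs.span B" "card B = fun_vs.dim E"
    by (rule fun_vs.basis_exists)
  then show ?thesis
    using fun_independent_finite(2)[OF assms(1) B(2)] assms(2) by (metis subsetD)
qed

text \<open>
  The subspace \<open>s E + t {f \<in> E. s f = 0}\<close> of \<open>E'\<close> has the dimension of \<open>E\<close>, since its two summands
  have disjoint supports, and the functionals given by \<open>\<omega>\<close> vanish on it.
\<close>
lemma dim_step:
  fixes E E' :: "('p \<Rightarrow> 'k::field) set" and s t :: "'p \<Rightarrow> 'k"
  assumes X: "finite X"
    and E: "fun_vs.subspace E" "\<And>f x. f \<in> E \<Longrightarrow> x \<notin> X \<Longrightarrow> f x = 0"
    and E': "\<And>f x. f \<in> E' \<Longrightarrow> x \<notin> X \<Longrightarrow> f x = 0"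
    and s: "\<And>f. f \<in> E \<Longrightarrow> (\<lambda>x. s x * f x) \<in> E'"
    and t: "\<And>f. f \<in> E \<Longrightarrow> (\<lambda>x. t x * f x) \<in> E'"
    and t_nz: "\<And>x. x \<in> X \<Longrightarrow> s x = 0 \<Longrightarrow> t x \<noteq> 0"
    and P: "finite P" "\<And>i. i \<in> P \<Longrightarrow> v i \<in> E'"
    and pair_diag: "\<And>i. i \<in> P \<Longrightarrow> (\<Sum>x\<in>X. \<omega> i x * v i x) \<noteq> 0"
    and pair_off: "\<And>i j. i \<in> P \<Longrightarrow> j \<in> P \<Longrightarrow> i \<noteq> j \<Longrightarrow> (\<Sum>x\<in>X. \<omega> i x * v j x) = 0"
    and kill_s: "\<And>i f. i \<in> P \<Longrightarrow> f \<in> E \<Longrightarrow> (\<Sum>x\<in>X. \<omega> i x * (s x * f x)) = 0"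
    and kill_t: "\<And>i f. i \<in> P \<Longrightarrow> f \<in> E \<Longrightarrow> (\<And>x. s x \<noteq> 0 \<Longrightarrow> f x = 0) \<Longrightarrow>
        (\<Sum>x\<in>X. \<omega> i x * (t x * f x)) = 0"
  shows "fun_vs.dim E + card P \<le> fun_vs.dim E'"
proof -
  \<comment> \<open>\<open>N\<close> consists of the functions of \<open>E\<close> supported on the
    zeros of \<open>s\<close>. A basis \<open>C\<close> of \<open>N\<close> is extended to a basis
    \<open>B\<close> of \<open>E\<close>; then multiplication by \<open>s\<close> is injective on
    the span of \<open>B - C\<close>, and multiplication by \<open>t\<close> is injective on
    \<open>N\<close>.\<close>
  define N where "N = {f \<in> E. \<forall>x. s x \<noteq> 0 \<longrightarrow> f x = 0}"
  have N: "fun_vs.subspace N"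
    using E(1) by (auto simp: N_def fun_vs.subspace_def)
  obtain C where C: "C \<subseteq> N" "fun_vs.independent C" "N \<subseteq> fun_vs.span C"
    by (rule fun_vs.basis_exists)
  have "C \<subseteq> E" using C(1) by (auto simp: N_def)
  then obtain B where B: "C \<subseteq> B" "B \<subseteq> E" "fun_vs.independent B" "E \<subseteq> fun_vs.span B"
    by (rule fun_vs.maximal_independent_subset_extend[OF _ C(2)])
  have finB: "finite B"
    using fun_independent_finite(1)[OF X B(3)] B(2) E(2) by blast
  have finC: "finite C" using finB B(1) by (rule finite_subset[rotated])
  have cardB: "card B = fun_vs.dim E"
    by (rule fun_vs.basis_card_eq_dim) (use B in auto)
  obtain T where T: "T \<subseteq> E'" "fun_vs.independent T" "E' \<subseteq> fun_vs.span T" "card T = fun_vs.dim E'"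
    by (rule fun_vs.basis_exists)
  have finT: "finite T"
    using fun_independent_finite(1)[OF X T(2)] T(1) E' by blast
  define g where "g = case_sum (\<lambda>b. if b \<in> C then (\<lambda>x. t x * b x) else (\<lambda>x. s x * b x)) v"
  have "card (B <+> P) \<le> card T"
  proof (rule fun_vs.indexed_independent_card_le[OF finT, where g = g])
    show "finite (B <+> P)" using finB P(1) by simp
    have "g i \<in> E'" if "i \<in> B <+> P" for i
      using that s t P(2) B(2) by (auto simp: g_def split: if_splits)
    then show "g ` (B <+> P) \<subseteq> fun_vs.span T" using T(3) by auto
  next
    fix c
    assume eq: "(\<Sum>i\<in>B <+> P. (\<lambda>x. c i * g i x)) = 0"
    \<comment> \<open>The relation becomes \<open>t * h + s * k\<close> plus a combination of the
      \<open>v i\<close>, with \<open>h\<close> from the span of \<open>C\<close> and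
      \<open>k\<close> from that of \<open>B - C\<close>.\<close>
    define h where "h = (\<lambda>x. \<Sum>b\<in>C. c (Inl b) * b x)"
    define k where "k = (\<lambda>x. \<Sum>b\<in>B - C. c (Inl b) * b x)"
    have h: "h \<in> N"
    proof -
      have "h = (\<Sum>b\<in>C. (\<lambda>x. c (Inl b) * b x))"
        by (auto simp: h_def fun_eq_iff sum_fun_apply)
      also have "\<dots> \<in> N"
        using C(1) by (intro fun_vs.subspace_sum[OF N] fun_vs.subspace_scale[OF N]) auto
      finally show ?thesis .
    qed
    have k: "k \<in> E"
    proof -
      have "k = (\<Sum>b\<in>B - C. (\<lambda>x. c (Inl b) * b x))"
        by (auto simp: k_def fun_eq_iff sum_fun_apply)
      also have "\<dots> \<in> E"
        using B(2) by (intro fun_vs.subspace_sum[OF E(1)] fun_vs.subspace_scale[OF E(1)]) auto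
      finally show ?thesis .
    qed
    have eq_at: "t x * h x + s x * k x + (\<Sum>i\<in>P. c (Inr i) * v i x) = 0" for x
    proof -
      have "0 = (\<Sum>i\<in>B <+> P. c i * g i x)"
        using fun_cong[OF eq, of x] by (simp add: sum_fun_apply)
      also have "\<dots> = (\<Sum>b\<in>B. c (Inl b) * g (Inl b) x) + (\<Sum>i\<in>P. c (Inr i) * v i x)"
        using finB P(1) by (simp add: sum.Plus g_def)
      also have "(\<Sum>b\<in>B. c (Inl b) * g (Inl b) x) =
          (\<Sum>b\<in>B - C. c (Inl b) * g (Inl b) x) + (\<Sum>b\<in>C. c (Inl b) * g (Inl b) x)"
        by (rule sum.subset_diff[OF B(1) finB])
      also have "(\<Sum>b\<in>B - C. c (Inl b) * g (Inl b) x) = s x * k x"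
        by (auto simp: g_def k_def sum_distrib_left mult.left_commute intro!: sum.cong)
      also have "(\<Sum>b\<in>C. c (Inl b) * g (Inl b) x) = t x * h x"
        by (auto simp: g_def h_def sum_distrib_left mult.left_commute intro!: sum.cong)
      finally show ?thesis by (simp add: add.commute)
    qed
    \<comment> \<open>Pairing the relation with \<open>\<omega> i\<close> kills the first two
      summands and isolates the coefficient of \<open>v i\<close>.\<close>
    have P0: "c (Inr i) = 0" if i: "i \<in> P" for i
    proof -
      have "0 = (\<Sum>x\<in>X. \<omega> i x * (t x * h x + s x * k x + (\<Sum>j\<in>P. c (Inr j) * v j x)))"
        by (simp add: eq_at)
      also have "\<dots> = (\<Sum>x\<in>X. \<omega> i x * (t x * h x)) + (\<Sum>x\<in>X. \<omega> i x * (s x * k x)) +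
          (\<Sum>x\<in>X. \<Sum>j\<in>P. c (Inr j) * (\<omega> i x * v j x))"
        by (simp add: distrib_left sum.distrib sum_distrib_left mult.left_commute)
      also have "(\<Sum>x\<in>X. \<omega> i x * (t x * h x)) = 0"
        using h by (intro kill_t i) (auto simp: N_def)
      also have "(\<Sum>x\<in>X. \<omega> i x * (s x * k x)) = 0"
        by (intro kill_s i k)
      also have "(\<Sum>x\<in>X. \<Sum>j\<in>P. c (Inr j) * (\<omega> i x * v j x)) =
          (\<Sum>j\<in>P. c (Inr j) * (\<Sum>x\<in>X. \<omega> i x * v j x))"
        by (subst sum.swap) (simp add: sum_distrib_left)
      also have "\<dots> = (\<Sum>j\<in>P. if j = i then c (Inr i) * (\<Sum>x\<in>X. \<omega> i x * v i x) else 0)"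
        by (rule sum.cong) (use pair_off[OF i] in auto)
      finally show ?thesis
        using i P(1) pair_diag[OF i] by simp
    qed
    then have eq_at': "t x * h x + s x * k x = 0" for x
      using eq_at[of x] by simp
    \<comment> \<open>Where \<open>s\<close> is nonzero, \<open>h\<close> vanishes, and hence so
      does \<open>k\<close>. Where \<open>s\<close> is 0, the relation reduces to
      \<open>t * h = 0\<close>, which will give \<open>h = 0\<close>.\<close>
    have "k \<in> N"
    proof -
      have "k x = 0" if "s x \<noteq> 0" for x
        using eq_at'[of x] h that by (auto simp: N_def)
      then show ?thesis using k by (simp add: N_def)
    qed
    have span_combo: "(\<Sum>b\<in>B. c (Inl b) * b x) = h x + k x" for x
      using sum.subset_diff[OF B(1) finB, of "\<lambda>b. c (Inl b) * b x"]
      by (simp add: h_def k_def)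
    have "h x = 0" for x
    proof (cases "x \<in> X \<and> s x = 0")
      case True
      then show ?thesis using eq_at'[of x] t_nz[of x] by auto
    next
      case False
      then show ?thesis using h E(2)[of h] by (auto simp: N_def)
    qed
    then have "h = 0" by auto
    then have "(\<Sum>b\<in>C. (\<lambda>x. c (Inl b) * b x)) = 0"
      by (auto simp: h_def fun_eq_iff sum_fun_apply)
    then have C0: "\<forall>b\<in>C. c (Inl b) = 0"
      using fun_vs.independentD[OF C(2) finC order_refl, of "\<lambda>b. c (Inl b)"] by blast
    \<comment> \<open>Now \<open>k\<close> lies in the spans of the two disjoint parts
      \<open>C\<close> and \<open>B - C\<close> of a basis, so all its coefficients vanish.\<close>
    have "k \<in> fun_vs.span C" using \<open>k \<in> N\<close> C(3) by auto
    then obtain u where u: "k = (\<Sum>b\<in>C. (\<lambda>x. u b * b x))"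
      using finC by (auto simp: fun_vs.span_finite)
    have "(\<Sum>b\<in>B. (\<lambda>x. (if b \<in> C then - u b else c (Inl b)) * b x)) = 0"
    proof
      fix x
      have "(\<Sum>b\<in>B. (if b \<in> C then - u b else c (Inl b)) * b x) =
          (\<Sum>b\<in>B - C. c (Inl b) * b x) + (\<Sum>b\<in>C. - (u b * b x))"
        by (subst sum.subset_diff[OF B(1) finB]) simp
      also have "\<dots> = 0"
        using fun_cong[OF u, of x] by (simp add: sum_fun_apply k_def sum_negf)
      finally show "(\<Sum>b\<in>B. (\<lambda>x. (if b \<in> C then - u b else c (Inl b)) * b x)) x = 0 x"
        by (simp add: sum_fun_apply)
    qed
    then have "\<forall>b\<in>B. (if b \<in> C then - u b else c (Inl b)) = 0"
      using fun_vs.independentD[OF B(3) finB order_refl, of "\<lambda>b. if b \<in> C then - u b else c (Inl b)"]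
      by blast
    then have "\<forall>b\<in>B. c (Inl b) = 0" using C0 by metis
    then show "\<forall>i\<in>B <+> P. c i = 0" using P0 by auto
  qed
  then show ?thesis
    using finB P(1) cardB T(4) by (simp add: card_Plus)
qed

section \<open>Linear forms as points, and the functions that forms induce on them\<close>

lemma scale_simps [simp]: "scale 0 p = 0" "scale c 0 = 0" "scale 1 p = p"
  by (simp_all add: scale_def)

text \<open>A linear form has constant derivatives, and \<open>lin u m\<close> is the constant in
  direction \<open>u\<close>. Directions thus serve as linear coordinates of the point
  \<open>m\<close>.\<close>

definition lin :: "(nat \<Rightarrow> 'k::field) \<Rightarrow> 'k mpol \<Rightarrow> 'k"
  where "lin u m = Poly_Mapping.lookup (dderiv u m) 0"

lemma dderiv_linear_form:
  assumes "m \<in> linear_forms n"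
  shows "dderiv u m = Poly_Mapping.single 0 (lin u m)"
proof -
  have "\<exists>c. dderiv u m = Poly_Mapping.single 0 c"
    using assms unfolding linear_forms_def
  proof (induction rule: mpol.span_induct_alt)
    case base
    show ?case by (auto intro: exI[of _ 0])
  next
    case (step c x y)
    then obtain i b where "x = Var i" "dderiv u y = Poly_Mapping.single 0 b" by auto
    then show ?case
      by (intro exI[of _ "c * u i + b"])
        (simp add: dderiv_add dderiv_scale dderiv_Var, simp add: scale_def mult_single single_add)
  qed
  then show ?thesis by (auto simp: lin_def)
qed

abbreviation lins :: "(nat \<Rightarrow> 'k::field) list \<Rightarrow> 'k mpol \<Rightarrow> 'k"
  where "lins us m \<equiv> prod_list (map (\<lambda>u. lin u m) us)"

lemma single_mult_0:
  "Poly_Mapping.single (0 :: nat \<Rightarrow>\<^sub>0 nat) (c * d) = Poly_Mapping.single 0 c * Poly_Mapping.single 0 d"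
  by (simp add: mult_single)

lemma dderiv_scale_power:
  fixes m :: "'k::field mpol"
  assumes "m \<in> linear_forms n"
  shows "dderiv u (scale c (m ^ Suc k)) = scale (of_nat (Suc k)) (scale (c * lin u m) (m ^ k))"
proof -
  have "dderiv u (scale c (m ^ Suc k)) =
      Poly_Mapping.single 0 c * (of_nat (Suc k) * m ^ k * Poly_Mapping.single 0 (lin u m))"
    by (simp only: dderiv_scale dderiv_power dderiv_linear_form[OF assms]) (simp add: scale_def)
  also have "\<dots> = scale (of_nat (Suc k)) (scale (c * lin u m) (m ^ k))"
    by (simp add: scale_def single_mult_0 mult_ac del: of_nat_Suc)
  finally show ?thesis .
qed

text \<open>Each derivative of a power of \<open>m\<close> contributes the old exponent and a factor
  \<open>lin u m\<close>; the exponents multiply up to the quotient of factorials. Differentiation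
  therefore only changes the weights of the points.\<close>

lemma foldr_dderiv_power_sum:
  fixes M :: "'k::field_char_0 mpol set"
  assumes M: "M \<subseteq> linear_forms n"
  shows "foldr dderiv us (\<Sum>m\<in>M. scale (c m) (m ^ (length us + k))) =
    scale (fact (length us + k) / fact k) (\<Sum>m\<in>M. scale (c m * lins us m) (m ^ k))"
proof (induction us arbitrary: k)
  case Nil
  then show ?case by simp
next
  case (Cons u us)
  have "foldr dderiv (u # us) (\<Sum>m\<in>M. scale (c m) (m ^ (length (u # us) + k))) =
      dderiv u (scale (fact (length us + Suc k) / fact (Suc k))
        (\<Sum>m\<in>M. scale (c m * lins us m) (m ^ Suc k)))"
    using Cons.IH[of "Suc k"] by simp
  also have "\<dots> = scale (fact (length us + Suc k) / fact (Suc k)) (\<Sum>m\<in>M.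
      scale (of_nat (Suc k)) (scale (c m * lins (u # us) m) (m ^ k)))"
    unfolding dderiv_scale[of _ "fact _ / fact _"] dderiv_sum
    by (intro arg_cong[where f = "scale _"] sum.cong refl)
      (use M in \<open>auto simp del: power_Suc of_nat_Suc simp: dderiv_scale_power mult_ac\<close>)
  also have "\<dots> = scale (fact (length us + Suc k) / fact (Suc k) * of_nat (Suc k))
      (\<Sum>m\<in>M. scale (c m * lins (u # us) m) (m ^ k))"
    by (simp only: mpol.scale_sum_right[symmetric] mpol.scale_scale[symmetric, of "fact _ / fact _"])
  also have "fact (length us + Suc k) / fact (Suc k) * of_nat (Suc k) =
      (fact (length (u # us) + k) / fact k :: 'k)"
    by (simp add: field_simps del: of_nat_Suc)
  finally show ?case .
qed

text \<open>
  The functions on \<open>X\<close> given by forms of degree \<open>k - 1\<close>. The shift by one provides the zero space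
  at \<open>k = 0\<close>.
\<close>
primrec form_funs :: "'k::field mpol set \<Rightarrow> nat \<Rightarrow> ('k mpol \<Rightarrow> 'k) set"
  where "form_funs X 0 = {0}"
  | "form_funs X (Suc k) = fun_vs.span
      ((if k = 0 then {\<lambda>m. of_bool (m \<in> X)} else {}) \<union> {\<lambda>m. lin u m * f m | u f. f \<in> form_funs X k})"

lemma form_funs_subspace: "fun_vs.subspace (form_funs X k)"
  by (cases k) (auto simp: fun_vs.subspace_single_0)

lemma form_funs_support:
  assumes "f \<in> form_funs X k" "m \<notin> X"
  shows "f m = 0"
  using assms(1)
proof (induction k arbitrary: f)
  case (Suc k)
  from Suc.prems show ?case unfolding form_funs.simps
  proof (induction rule: fun_vs.span_induct_alt)
    case (step c x y)
    then show ?case using Suc.IH assms(2) by (auto split: if_splits)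
  qed auto
qed auto

lemma form_funs_lin: "f \<in> form_funs X k \<Longrightarrow> (\<lambda>m. lin u m * f m) \<in> form_funs X (Suc k)"
  unfolding form_funs.simps by (rule fun_vs.span_base) auto

lemma form_funs_lins:
  "f \<in> form_funs X k \<Longrightarrow> (\<lambda>m. lins us m * f m) \<in> form_funs X (length us + k)"
proof (induction us)
  case (Cons u us)
  then show ?case
    using form_funs_lin[of "\<lambda>m. lins us m * f m"] by (simp add: mult.assoc del: form_funs.simps)
qed simp

lemma form_funs_one: "(\<lambda>m. of_bool (m \<in> X)) \<in> form_funs X (Suc 0)"
  unfolding form_funs.simps by (rule fun_vs.span_base) simp

text \<open>A relation among \<open>k\<close>-th powers annihilates forms of degree
  \<open>k\<close>, which have index \<open>Suc k\<close> in \<open>form_funs\<close>.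
  Differentiating the relation peels linear factors off \<open>f\<close> one at a time; the exponent
  cancels in characteristic 0.\<close>

lemma form_funs_apolar:
  fixes X :: "'k::field_char_0 mpol set"
  assumes X: "X \<subseteq> linear_forms n" "finite X"
    and "(\<Sum>m\<in>X. scale (w m) (m ^ k)) = 0" "f \<in> form_funs X (Suc k)"
  shows "(\<Sum>m\<in>X. w m * f m) = 0"
  using assms(3,4)
proof (induction k arbitrary: w f)
  case 0
  have "(\<Sum>m\<in>X. w m) = Poly_Mapping.lookup (\<Sum>m\<in>X. scale (w m) (m ^ 0)) 0"
    by (simp add: lookup_sum scale_def)
  then have w: "(\<Sum>m\<in>X. w m) = 0" using 0 by simp
  from 0(2) show ?case unfolding form_funs.simps
  proof (induction rule: fun_vs.span_induct_alt)
    case (step c x y)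
    then show ?case using w X(2)
      by (auto simp: distrib_left sum.distrib mult.left_commute simp flip: sum_distrib_left)
  qed auto
next
  case (Suc k)
  from Suc.prems(2) show ?case unfolding form_funs.simps(2)[of _ "Suc k"]
  proof (induction rule: fun_vs.span_induct_alt)
    case (step c x y)
    then obtain u f where x: "x = (\<lambda>m. lin u m * f m)" and f: "f \<in> form_funs X (Suc k)"
      by (auto simp del: form_funs.simps)
    have "scale (of_nat (Suc k)) (\<Sum>m\<in>X. scale (w m * lin u m) (m ^ k)) =
        dderiv u (\<Sum>m\<in>X. scale (w m) (m ^ Suc k))"
      unfolding dderiv_sum mpol.scale_sum_right
      by (rule sum.cong) (use X(1) in \<open>auto simp del: power_Suc of_nat_Suc simp: dderiv_scale_power\<close>)
    then have "scale (of_nat (Suc k)) (\<Sum>m\<in>X. scale (w m * lin u m) (m ^ k)) = 0"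
      using Suc.prems(1) by simp
    then have "(\<Sum>m\<in>X. scale (w m * lin u m) (m ^ k)) = 0"
      by (simp only: mpol.scale_eq_0_iff of_nat_eq_0_iff) simp
    from Suc.IH[OF this f] have "(\<Sum>m\<in>X. w m * x m) = 0"
      by (simp add: x mult.assoc)
    with step show ?case
      by (simp add: distrib_left sum.distrib mult.left_commute flip: sum_distrib_left)
  qed simp
qed

text \<open>A combination that is nonzero at the earlier points is changed by a multiple
  \<open>\<epsilon>\<close> of some \<open>Y a\<close> that is nonzero at the new point. The finite
  set \<open>S\<close> contains all values of \<open>\<epsilon>\<close> that would produce a zero at
  a point where \<open>Y a\<close> is nonzero.\<close>

lemma ex_combination_nonzero:
  fixes Y :: "'a \<Rightarrow> 'b \<Rightarrow> 'k::field_char_0"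
  assumes "finite B" "finite J" "\<And>m. m \<in> B \<Longrightarrow> \<exists>a\<in>J. Y a m \<noteq> 0"
  shows "\<exists>\<tau>. \<forall>m\<in>B. (\<Sum>a\<in>J. \<tau> a * Y a m) \<noteq> 0"
  using assms(1,3)
proof (induction B)
  case (insert m B)
  then obtain \<tau> where \<tau>: "\<forall>m\<in>B. (\<Sum>a\<in>J. \<tau> a * Y a m) \<noteq> 0" by auto
  obtain a where a: "a \<in> J" "Y a m \<noteq> 0" using insert.prems[of m] by auto
  define S where "S = (\<lambda>m'. - (\<Sum>a\<in>J. \<tau> a * Y a m') / Y a m') ` insert m B \<union> {0}"
  have "finite S" using insert.hyps by (simp add: S_def)
  then obtain \<epsilon> where \<epsilon>: "\<epsilon> \<notin> S"
    using ex_new_if_finite infinite_UNIV_char_0 by blast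
  have eq: "(\<Sum>b\<in>J. (\<tau> b + (if b = a then \<epsilon> else 0)) * Y b m') =
      (\<Sum>b\<in>J. \<tau> b * Y b m') + \<epsilon> * Y a m'" for m'
  proof -
    have "(\<Sum>b\<in>J. (\<tau> b + (if b = a then \<epsilon> else 0)) * Y b m') =
        (\<Sum>b\<in>J. \<tau> b * Y b m' + (if b = a then \<epsilon> * Y a m' else 0))"
      by (rule sum.cong) (auto simp: distrib_right)
    then show ?thesis using a(1) assms(2) by (simp add: sum.distrib)
  qed
  have "(\<Sum>b\<in>J. \<tau> b * Y b m') + \<epsilon> * Y a m' \<noteq> 0" if m': "m' \<in> insert m B" for m'
  proof (cases "Y a m' = 0")
    case True
    then show ?thesis using \<tau> m' a(2) by auto
  next
    case False
    have "\<epsilon> \<noteq> - (\<Sum>a\<in>J. \<tau> a * Y a m') / Y a m'" using \<epsilon> m' by (auto simp: S_def)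
    then have "\<epsilon> * Y a m' \<noteq> - (\<Sum>a\<in>J. \<tau> a * Y a m')" 
      using False by (metis nonzero_mult_div_cancel_right)
    then show ?thesis by (metis add_eq_0_iff)
  qed
  then show ?case by (intro exI[of _ "\<lambda>b. \<tau> b + (if b = a then \<epsilon> else 0)"]) (simp add: eq)
qed simp

section \<open>The apolarity bound\<close>

lemma single_eq_0_iff: "Poly_Mapping.single k x = 0 \<longleftrightarrow> x = 0"
  by (metis lookup_single_eq lookup_zero single_zero)

text \<open>The coefficients are indexed by \<open>M\<close> and not by its image, so that a
  decomposition becomes a weighting of its linear forms.\<close>

lemma (in vector_space) span_image_ex_sum:
  assumes "finite M" "x \<in> span (f ` M)"
  shows "\<exists>c. x = (\<Sum>m\<in>M. c m *s f m)"
  using assms(2)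
proof (induction rule: span_induct_alt)
  case base
  show ?case by (intro exI[of _ "\<lambda>_. 0"]) simp
next
  case (step a y z)
  then obtain m c where m: "m \<in> M" "y = f m" and c: "z = (\<Sum>m\<in>M. c m *s f m)" by auto
  have "(\<Sum>k\<in>M. (c k + (if k = m then a else 0)) *s f k) =
      (\<Sum>k\<in>M. c k *s f k + (if k = m then a *s f m else 0))"
    by (rule sum.cong) (auto simp: scale_left_distrib)
  also have "\<dots> = a *s y + z"
    using m c assms(1) by (simp add: sum.distrib add.commute)
  finally show ?case by metis
qed

text \<open>A decomposition has as many representatives as points, so it suffices to count linear
  forms in an arbitrary combination of powers.\<close>

lemma srk_ge:
  assumes "\<And>M c. finite M \<Longrightarrow> M \<subseteq> linear_forms n \<Longrightarrow> F = (\<Sum>m\<in>M. scale (c m) (m ^ d)) \<Longrightarrow> k \<le> card M"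
  shows "enat k \<le> srk n d F"
  unfolding srk_def
proof (rule INF_greatest)
  fix Z assume "Z \<in> {Z. symmetric_decomposition n d F Z}"
  then obtain M where M: "finite Z" "M \<subseteq> linear_forms n - {0}" "bij_betw proj_point M Z"
      "F \<in> mpol.span ((\<lambda>m. m ^ d) ` M)"
    by (auto simp: symmetric_decomposition_def)
  have "finite M" using M by (simp add: bij_betw_finite)
  then obtain c where "F = (\<Sum>m\<in>M. scale (c m) (m ^ d))"
    using mpol.span_image_ex_sum M(4) by blast
  then have "k \<le> card M" using assms[of M c] M(2) \<open>finite M\<close> by auto
  then show "enat k \<le> enat (card Z)" using bij_betw_same_card[OF M(3)] by simp
qed

text \<open>
  Directions are named by indices, and \<open>D i\<close> differentiates in direction \<open>u i\<close>. The elements \<open>(ws, vs)\<close>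
  of \<open>P j\<close> consist of a derivative of \<open>F\<close> of order \<open>d - j\<close>, hence a functional on forms of degree \<open>j\<close>,
  and the product of \<open>j\<close> coordinates dual to it.
\<close>
lemma apolar_bound:
  fixes F :: "'k::field_char_0 mpol" and u :: "'i \<Rightarrow> nat \<Rightarrow> 'k" and P :: "nat \<Rightarrow> ('i list \<times> 'i list) set"
  defines "D \<equiv> \<lambda>i. dderiv (u i)"
  assumes d: "d \<ge> 2"
    and J: "finite J" "J \<noteq> {}"
    and Jz: "\<And>a. a \<in> J \<Longrightarrow> D z (D a F) = 0"
    and JJ: "\<And>a b. a \<in> J \<Longrightarrow> b \<in> J \<Longrightarrow> a \<noteq> b \<Longrightarrow> D b (D a F) = 0"
    and Je: "\<And>a. a \<in> J \<Longrightarrow> D a (D a F) = scale \<kappa> (D e (D z F))" and \<kappa>: "\<kappa> \<noteq> 0"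
    and finP: "\<And>j. j < d \<Longrightarrow> finite (P j)"
    and lens: "\<And>j ws vs. j < d \<Longrightarrow> (ws, vs) \<in> P j \<Longrightarrow> length ws = d - j \<and> length vs = j"
    and adm: "\<And>j ws vs. j < d \<Longrightarrow> (ws, vs) \<in> P j \<Longrightarrow> (\<exists>a\<in>J. \<exists>r. ws = a # r) \<or> (\<exists>r. ws = z # e # r) \<or>
        (\<exists>r. ws = z # r) \<and> D z (D z F) = 0"
    and diag: "\<And>j ws vs. j < d \<Longrightarrow> (ws, vs) \<in> P j \<Longrightarrow> fold D (ws @ vs) F \<noteq> 0"
    and off: "\<And>j ws vs ws' vs'. j < d \<Longrightarrow> (ws, vs) \<in> P j \<Longrightarrow> (ws', vs') \<in> P j \<Longrightarrow>
        (ws, vs) \<noteq> (ws', vs') \<Longrightarrow> fold D (ws @ vs') F = 0"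
  shows "enat (\<Sum>j<d. card (P j)) \<le> srk n d F"
proof (rule srk_ge)
  fix M :: "'k mpol set" and c
  assume M: "finite M" "M \<subseteq> linear_forms n" and F: "F = (\<Sum>m\<in>M. scale (c m) (m ^ d))"
  define L where "L = (\<lambda>i. lin (u i))"
  define Ls where "Ls = (\<lambda>is m. \<Prod>i\<leftarrow>is. L i m)"
  have Ls_simps [simp]: "Ls [] m = 1" "Ls (i # is) m = L i m * Ls is m" "Ls (is @ js) m = Ls is m * Ls js m"
    for i "is" js m by (simp_all add: Ls_def)
  have Ls_lins: "Ls is = lins (map u is)" for "is"
    by (induction "is") (simp_all add: fun_eq_iff L_def)
  \<comment> \<open>At a discarded point \<open>L z\<close> and all \<open>L a\<close> with
    \<open>a \<in> J\<close> are 0, so it drops out of every derivative whose directions include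
    \<open>z\<close> or a member of \<open>J\<close>.\<close>
  define X where "X = {m \<in> M. L z m \<noteq> 0 \<or> (\<exists>a\<in>J. L a m \<noteq> 0)}"
  have X: "X \<subseteq> linear_forms n" "finite X" using M by (auto simp: X_def)
  have X_off: "L a m = 0" if "a \<in> insert z J" "m \<in> M - X" for a m
    using that by (auto simp: X_def)
  \<comment> \<open>This generic combination will be the multiplier \<open>t\<close> of
    \<open>dim_step\<close>, next to \<open>L z\<close> as the multiplier \<open>s\<close>.\<close>
  have "\<exists>\<tau>. \<forall>m\<in>{m\<in>X. L z m = 0}. (\<Sum>a\<in>J. \<tau> a * L a m) \<noteq> 0"
  proof (rule ex_combination_nonzero)
    show "finite {m\<in>X. L z m = 0}" using X(2) by simp
    show "\<exists>a\<in>J. L a m \<noteq> 0" if "m \<in> {m\<in>X. L z m = 0}" for m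
      using that by (simp add: X_def)
  qed (rule J(1))
  then obtain \<tau> where \<tau>: "\<forall>m\<in>{m\<in>X. L z m = 0}. (\<Sum>a\<in>J. \<tau> a * L a m) \<noteq> 0"
    by blast
  define t where "t = (\<lambda>m. \<Sum>a\<in>J. \<tau> a * L a m)"
  have F2: "D b (D a F) =
      scale (fact d / fact (d - 2)) (\<Sum>m\<in>M. scale (c m * L a m * L b m) (m ^ (d - 2)))" for a b
    using foldr_dderiv_power_sum[OF M(2), of "[u b, u a]" c "d - 2"] d
    by (simp add: F D_def L_def mult_ac Suc_diff_Suc numeral_2_eq_2)
  have M_X: "(\<Sum>m\<in>M. scale (c m * L a m * L b m) (m ^ k)) =
      (\<Sum>m\<in>X. scale (c m * L a m * L b m) (m ^ k))"
    if "a \<in> insert z J \<or> b \<in> insert z J" for a b k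
  proof (rule sum.mono_neutral_right)
    show "\<forall>m\<in>M - X. scale (c m * L a m * L b m) (m ^ k) = 0"
    proof
      fix m assume "m \<in> M - X"
      then have "L a m = 0 \<or> L b m = 0" using that X_off by blast
      then show "scale (c m * L a m * L b m) (m ^ k) = 0" by auto
    qed
  qed (use M in \<open>auto simp: X_def\<close>)
  have fact_nz: "(fact d / fact (d - 2) :: 'k) \<noteq> 0" by simp
  \<comment> \<open>A vanishing second derivative is a relation among the powers
    \<open>m ^ (d - 2)\<close>, so its weights annihilate forms of degree \<open>d - 2\<close>, that
    is, \<open>form_funs\<close> at index \<open>d - 1\<close>.\<close>
  have pair0: "(\<Sum>m\<in>X. c m * L a m * L b m * f m) = 0"
    if "D b (D a F) = 0" "a \<in> insert z J" "f \<in> form_funs X (d - 1)" for a b f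
  proof (rule form_funs_apolar[OF X])
    have "(\<Sum>m\<in>M. scale (c m * L a m * L b m) (m ^ (d - 2))) = 0"
      using that(1) fact_nz unfolding F2 mpol.scale_eq_0_iff by blast
    then show "(\<Sum>m\<in>X. scale (c m * L a m * L b m) (m ^ (d - 2))) = 0"
      using that(2) by (subst (asm) M_X) auto
    have "Suc (d - 2) = d - 1" using d by simp
    then show "f \<in> form_funs X (Suc (d - 2))" using that(3) by simp
  qed
  have pair_e: "(\<Sum>m\<in>X. c m * L a m * L a m * f m) = \<kappa> * (\<Sum>m\<in>X. c m * L z m * L e m * f m)"
    if "a \<in> J" "f \<in> form_funs X (d - 1)" for a f
  proof -
    let ?C = "fact d / fact (d - 2) :: 'k"
    have "scale ?C (\<Sum>m\<in>M. scale (c m * L a m * L a m) (m ^ (d - 2))) =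
        scale ?C (scale \<kappa> (\<Sum>m\<in>M. scale (c m * L z m * L e m) (m ^ (d - 2))))"
      using Je[OF that(1)] unfolding F2 by (simp only: mpol.scale_left_commute)
    then have "(\<Sum>m\<in>M. scale (c m * L a m * L a m) (m ^ (d - 2))) =
        scale \<kappa> (\<Sum>m\<in>M. scale (c m * L z m * L e m) (m ^ (d - 2)))"
      using fact_nz unfolding mpol.scale_cancel_left by blast
    then have "(\<Sum>m\<in>X. scale (c m * L a m * L a m - \<kappa> * (c m * L z m * L e m)) (m ^ (d - 2))) = 0"
      using that(1) by (simp add: M_X mpol.scale_left_diff_distrib sum_subtractf mpol.scale_sum_right)
    then have "(\<Sum>m\<in>X. (c m * L a m * L a m - \<kappa> * (c m * L z m * L e m)) * f m) = 0"
      by (rule form_funs_apolar[OF X]) (use that(2) d in \<open>simp add: Suc_diff_Suc numeral_2_eq_2\<close>)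
    then show ?thesis by (simp add: left_diff_distrib sum_subtractf sum_distrib_left mult.assoc)
  qed
  \<comment> \<open>Derivatives of order \<open>d\<close> are constants: up to the factor
    \<open>fact d\<close> they are the values of the functional on products of \<open>d\<close>
    coordinates.\<close>
  have const: "fold D us F = Poly_Mapping.single 0 (fact d * (\<Sum>m\<in>M. c m * Ls us m))"
    if "length us = d" for us
  proof -
    have "fold D us F = scale (fact d) (\<Sum>m\<in>M. scale (c m * Ls us m) 1)"
      using foldr_dderiv_power_sum[OF M(2), of "rev (map u us)" c 0] that
      by (simp add: F D_def foldr_conv_fold fold_map comp_def Ls_def L_def rev_map[symmetric] prod_list.rev)
    also have "(\<Sum>m\<in>M. scale (c m * Ls us m) 1) = Poly_Mapping.single 0 (\<Sum>m\<in>M. c m * Ls us m)"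
      using M(1) by (induction M) (simp_all add: scale_def single_add)
    finally show ?thesis by (simp add: scale_def mult_single)
  qed
  define \<omega> where "\<omega> = (\<lambda>(p :: 'i list \<times> 'i list) m. c m * Ls (fst p) m)"
  define v where "v = (\<lambda>(p :: 'i list \<times> 'i list) m. Ls (snd p) m * of_bool (m \<in> X))"
  have adm_J: "\<exists>a r. a \<in> insert z J \<and> ws = a # r" if "j < d" "(ws, vs) \<in> P j" for j ws vs
    using adm[OF that] by blast
  \<comment> \<open>The list \<open>fst p\<close> is headed by \<open>z\<close> or a member of
    \<open>J\<close>, so the discarded points do not contribute and the pairing is a derivative of
    \<open>F\<close> of order \<open>d\<close>.\<close>
  have pairing: "fact d * (\<Sum>m\<in>X. \<omega> p m * v q m) =
      Poly_Mapping.lookup (fold D (fst p @ snd q) F) 0"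
    if j: "j < d" and p: "p \<in> P j" and q: "q \<in> P j" for j p q
  proof -
    have len: "length (fst p @ snd q) = d"
      using lens[OF j, of "fst p" "snd p"] lens[OF j, of "fst q" "snd q"] j p q by simp
    obtain a r where a: "a \<in> insert z J" "fst p = a # r"
      using adm_J[OF j, of "fst p" "snd p"] p by auto
    have "(\<Sum>m\<in>X. \<omega> p m * v q m) = (\<Sum>m\<in>M. c m * Ls (fst p @ snd q) m)"
      unfolding \<omega>_def v_def
    proof (rule sum.mono_neutral_cong_left)
      show "\<forall>m\<in>M - X. c m * Ls (fst p @ snd q) m = 0"
        using X_off[OF a(1)] a(2) by simp
    qed (use M(1) in \<open>auto simp: X_def\<close>)
    then show ?thesis by (simp only: const[OF len] lookup_single_eq)
  qed
  have const_iff: "Poly_Mapping.lookup (fold D us F) 0 = 0 \<longleftrightarrow> fold D us F = 0"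
    if "length us = d" for us
    unfolding const[OF that] lookup_single_eq single_eq_0_iff ..
  \<comment> \<open>These are the two vanishing conditions of \<open>dim_step\<close>. All
    directions in \<open>ws\<close> except the first raise \<open>f\<close> to degree
    \<open>d - 2\<close>; the first one, together with the multiplier, forms a second derivative of
    \<open>F\<close>.\<close>
  have kill: "(\<Sum>m\<in>X. \<omega> p m * (L z m * f m)) = 0 \<and>
      ((\<forall>m. L z m \<noteq> 0 \<longrightarrow> f m = 0) \<longrightarrow> (\<Sum>m\<in>X. \<omega> p m * (t m * f m)) = 0)"
    if j: "j < d" and p: "p \<in> P j" and f: "f \<in> form_funs X j" for j p f
  proof -
    obtain ws vs where p_eq: "p = (ws, vs)" by (cases p)
    have len: "length ws = d - j" using lens[OF j, of ws vs] p p_eq by simp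
    have r1: "(\<lambda>m. Ls r m * f m) \<in> form_funs X (d - 1)" if "ws = a # r" for a r
    proof -
      have "length r + j = d - 1" using len that j by simp
      then show ?thesis using form_funs_lins[OF f, of "map u r"] by (simp add: Ls_lins)
    qed
    have zt: "(\<Sum>m\<in>X. \<omega> p m * (t m * f m)) = 0"
      if "ws = z # r" "\<forall>m. L z m \<noteq> 0 \<longrightarrow> f m = 0" for r
      by (rule sum.neutral) (use that p_eq in \<open>auto simp: \<omega>_def\<close>)
    consider (J) a r where "a \<in> J" "ws = a # r" | (ze) r where "ws = z # e # r"
      | (zz) r where "ws = z # r" "D z (D z F) = 0"
      using adm[OF j, of ws vs] p p_eq by blast
    then show ?thesis
    proof cases
      case J
      have "(\<Sum>m\<in>X. c m * L a m * L z m * (Ls r m * f m)) = 0"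
        using J by (intro pair0 Jz r1) auto
      then have "(\<Sum>m\<in>X. \<omega> p m * (L z m * f m)) = 0"
        by (simp add: \<omega>_def p_eq J(2) mult_ac)
      moreover have "(\<Sum>m\<in>X. \<omega> p m * (t m * f m)) = 0" if f0: "\<forall>m. L z m \<noteq> 0 \<longrightarrow> f m = 0"
      proof -
        have b: "(\<Sum>m\<in>X. c m * L a m * L b m * (Ls r m * f m)) = 0" if "b \<in> J" for b
        proof (cases "b = a")
          \<comment> \<open>\<open>Je\<close> trades the square of the coordinate \<open>a\<close>
            for a multiple of \<open>L z * L e\<close>, and \<open>f\<close> vanishes wherever
            \<open>L z\<close> does not.\<close>
          case True
          have "(\<Sum>m\<in>X. c m * L a m * L a m * (Ls r m * f m)) =
              \<kappa> * (\<Sum>m\<in>X. c m * L z m * L e m * (Ls r m * f m))"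
            using J by (intro pair_e r1)
          also have "(\<Sum>m\<in>X. c m * L z m * L e m * (Ls r m * f m)) = 0"
            by (rule sum.neutral) (use f0 in auto)
          finally show ?thesis using True by simp
        next
          case False
          then show ?thesis using J that by (intro pair0 JJ r1) auto
        qed
        have "(\<Sum>m\<in>X. \<omega> p m * (t m * f m)) =
            (\<Sum>m\<in>X. \<Sum>b\<in>J. \<tau> b * (c m * L a m * L b m * (Ls r m * f m)))"
          by (simp add: \<omega>_def p_eq J(2) t_def sum_distrib_left sum_distrib_right mult_ac)
        also have "\<dots> = (\<Sum>b\<in>J. \<tau> b * (\<Sum>m\<in>X. c m * L a m * L b m * (Ls r m * f m)))"
          by (subst sum.swap) (simp add: sum_distrib_left)
        also have "\<dots> = 0" by (simp add: b)
        finally show ?thesis .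
      qed
      ultimately show ?thesis by blast
    next
      \<comment> \<open>Here \<open>Je\<close> is used in the other direction:
        \<open>L z * L e\<close> is traded for the square of a coordinate from \<open>J\<close>, and
        the additional factor \<open>L z\<close> then produces a mixed derivative that is 0.\<close>
      case ze
      obtain a where a: "a \<in> J" using J(2) by blast
      have r2: "(\<lambda>m. Ls (x # r) m * f m) \<in> form_funs X (d - 1)" for x
      proof -
        have "length (x # r) + j = d - 1" using len ze j by simp
        then show ?thesis using form_funs_lins[OF f, of "map u (x # r)"] by (simp only: Ls_lins length_map)
      qed
      have "\<kappa> * (\<Sum>m\<in>X. c m * L z m * L e m * (Ls (z # r) m * f m)) =
          (\<Sum>m\<in>X. c m * L a m * L a m * (Ls (z # r) m * f m))"
        using a r2 by (intro pair_e[symmetric])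
      also have "\<dots> = (\<Sum>m\<in>X. c m * L a m * L z m * (Ls (a # r) m * f m))"
        by (simp add: mult_ac)
      also have "\<dots> = 0"
        using a r2 by (intro pair0 Jz) auto
      finally have "(\<Sum>m\<in>X. c m * L z m * L e m * (Ls (z # r) m * f m)) = 0" using \<kappa> by simp
      then have "(\<Sum>m\<in>X. \<omega> p m * (L z m * f m)) = 0"
        by (simp add: \<omega>_def p_eq ze mult_ac)
      then show ?thesis using zt[OF ze] by blast
    next
      case zz
      have "(\<Sum>m\<in>X. c m * L z m * L z m * (Ls r m * f m)) = 0"
        using zz by (intro pair0 r1) auto
      then have "(\<Sum>m\<in>X. \<omega> p m * (L z m * f m)) = 0"
        by (simp add: \<omega>_def p_eq zz(1) mult_ac)
      then show ?thesis using zt[OF zz(1)] by blast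
    qed
  qed
  have L_form: "(\<lambda>m. L i m * f m) \<in> form_funs X (Suc j)" if "f \<in> form_funs X j" for f i j
    using form_funs_lin[OF that] by (simp only: L_def)
  have t_form: "(\<lambda>m. t m * f m) \<in> form_funs X (Suc j)" if "f \<in> form_funs X j" for f j
  proof -
    have "(\<lambda>m. t m * f m) = (\<Sum>a\<in>J. (\<lambda>m. \<tau> a * (L a m * f m)))"
      by (auto simp: fun_eq_iff t_def sum_fun_apply sum_distrib_right mult.assoc)
    also have "\<dots> \<in> form_funs X (Suc j)"
      by (intro fun_vs.subspace_sum[OF form_funs_subspace]
          fun_vs.subspace_scale[OF form_funs_subspace] L_form that)
    finally show ?thesis .
  qed
  have step: "fun_vs.dim (form_funs X j) + card (P j) \<le> fun_vs.dim (form_funs X (Suc j))"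
    if j: "j < d" for j
  proof (rule dim_step[where X = X and s = "L z" and t = t and v = v and \<omega> = \<omega>])
    show "v p \<in> form_funs X (Suc j)" if "p \<in> P j" for p
      using form_funs_lins[OF form_funs_one, of "map u (snd p)" X] lens[OF j, of "fst p" "snd p"] that
      by (simp add: v_def Ls_lins del: form_funs.simps)
    show "(\<Sum>m\<in>X. \<omega> p m * v p m) \<noteq> 0" if "p \<in> P j" for p
    proof -
      have "Poly_Mapping.lookup (fold D (fst p @ snd p) F) 0 \<noteq> 0"
        using diag[OF j, of "fst p" "snd p"] lens[OF j, of "fst p" "snd p"] that j
        by (subst const_iff) auto
      then show ?thesis using pairing[OF j that that] by auto
    qed
    show "(\<Sum>m\<in>X. \<omega> p m * v q m) = 0" if "p \<in> P j" "q \<in> P j" "p \<noteq> q" for p q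
    proof -
      have "fold D (fst p @ snd q) F = 0"
        using off[OF j, of "fst p" "snd p" "fst q" "snd q"] that by auto
      then show ?thesis using pairing[OF j that(1,2)] by auto
    qed
    show "(\<Sum>m\<in>X. \<omega> p m * (L z m * f m)) = 0" if "p \<in> P j" "f \<in> form_funs X j" for p f
      using kill[OF j that] by blast
    show "(\<Sum>m\<in>X. \<omega> p m * (t m * f m)) = 0"
      if "p \<in> P j" "f \<in> form_funs X j" "\<And>m. L z m \<noteq> 0 \<Longrightarrow> f m = 0" for p f
      using kill[OF j that(1,2)] that(3) by blast
    show "t m \<noteq> 0" if "m \<in> X" "L z m = 0" for m
      using \<tau> that by (auto simp: t_def)
  qed (use X finP[OF j] form_funs_subspace L_form t_form form_funs_support in
    \<open>blast+\<close>)
  \<comment> \<open>The increments add up, starting from the zero space at index 0.\<close>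
  have "(\<Sum>j<k. card (P j)) \<le> fun_vs.dim (form_funs X k)" if "k \<le> d" for k
    using that
  proof (induction k)
    case (Suc k)
    then show ?case using step[of k] by simp
  qed simp
  then have "(\<Sum>j<d. card (P j)) \<le> fun_vs.dim (form_funs X d)" by simp
  also have "\<dots> \<le> card X"
    using X(2) form_funs_support by (rule fun_dim_le_card)
  also have "\<dots> \<le> card M" using M(1) by (intro card_mono) (auto simp: X_def)
  finally show "(\<Sum>j<d. card (P j)) \<le> card M" .
qed

section \<open>Lower bounds for reducible quartics\<close>

lemma dderiv_numeral [simp]: "dderiv v (numeral k) = 0"
  using dderiv_const[of v "numeral k"] by (simp only: single_numeral)

lemma dderiv_one [simp]: "dderiv v 1 = 0"
  using dderiv_const[of v 1] by simp

lemma dderiv_of_bool [simp]: "dderiv v (of_bool b) = 0"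
  by (cases b) simp_all

lemma dderiv_square: "dderiv v (p\<^sup>2) = 2 * p * dderiv v p"
  by (simp add: power2_eq_square dderiv_mult)

lemma dderiv_sum_squares:
  assumes "\<And>j. j \<in> I \<Longrightarrow> dderiv v (y j) = of_bool (a = j)" "finite I"
  shows "dderiv v (\<Sum>j\<in>I. (y j)\<^sup>2) = (if a \<in> I then 2 * y a else 0)"
proof -
  have "dderiv v (\<Sum>j\<in>I. (y j)\<^sup>2) = (\<Sum>j\<in>I. if j = a then 2 * y a else 0)"
    unfolding dderiv_sum by (rule sum.cong) (auto simp: dderiv_square assms(1))
  then show ?thesis using assms(2) by simp
qed

lemma less_4_cases [consumes 1]:
  assumes "(j::nat) < 4" obtains "j = 0" | "j = 1" | "j = 2" | "j = 3"
  using assms by linarith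

lemma card_Un_images:
  assumes "finite T" "inj_on f T" "inj_on g T" "\<And>a b. a \<in> T \<Longrightarrow> b \<in> T \<Longrightarrow> f a \<noteq> g b"
  shows "card (f ` T \<union> g ` T) = 2 * card T"
proof -
  have "f ` T \<inter> g ` T = {}" using assms(4) by auto
  then show ?thesis using assms(1-3) by (simp add: card_Un_disjoint card_image)
qed

text \<open>All squares have the same second derivative \<open>2 * (y 0 * y 1)\<close>. Direction
  \<open>n\<close> is singled out to serve as both \<open>z\<close> and \<open>e\<close>, and the
  remaining squares form \<open>J\<close>.\<close>

lemma srk_ge_secant:
  fixes y :: "nat \<Rightarrow> 'k::field_char_0 mpol" and u :: "nat \<Rightarrow> nat \<Rightarrow> 'k"
  assumes n: "n \<ge> 3"
    and dual: "\<And>i j. i \<le> n \<Longrightarrow> j \<le> n \<Longrightarrow> dderiv (u i) (y j) = of_bool (i = j)"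
    and Q: "\<And>i. i \<in> {2..n} \<Longrightarrow> dderiv (u i) Q = 0"
  shows "enat (4 * (n - 1)) \<le> srk n 4 (y 0 * y 1 * ((\<Sum>i=2..n. (y i)\<^sup>2) + Q))"
proof -
  define F where "F = y 0 * y 1 * ((\<Sum>i=2..n. (y i)\<^sup>2) + Q)"
  define T where "T = {2..<n}"
  \<comment> \<open>A list headed by \<open>n\<close> has to continue with \<open>n\<close>, since
    the second derivative in direction \<open>n\<close> is nonzero; hence \<open>n\<close>
    contributes nothing for \<open>j = 3\<close>. The four cardinalities are 1, n, 2n - 3 and n -
    2.\<close>
  define P :: "nat \<Rightarrow> (nat list \<times> nat list) set" where "P = (\<lambda>j.
    if j = 0 then {([n, n, 0, 1], [])}
    else if j = 1 then {([n, n, 0], [1]), ([n, n, 1], [0])} \<union> (\<lambda>a. ([a, 0, 1], [a])) ` T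
    else if j = 2 then {([n, n], [0, 1])} \<union> (\<lambda>a. ([a, 1], [0, a])) ` T \<union> (\<lambda>a. ([a, 0], [1, a])) ` T
    else (\<lambda>a. ([a], [0, 1, a])) ` T)"
  have T: "finite T" "card T = n - 2" "n \<notin> T" "0 \<notin> T" "Suc 0 \<notin> T" "T \<noteq> {}" "a \<in> T \<Longrightarrow> a \<le> n" for a
    using n by (auto simp: T_def)
  have DF: "dderiv (u a) F = 2 * (y 0 * y 1 * y a)" if "a \<in> insert n T" for a
  proof -
    have a: "2 \<le> a" "a \<le> n" using that n by (auto simp: T_def)
    then have "dderiv (u a) (\<Sum>i=2..n. (y i)\<^sup>2) = 2 * y a"
      using dderiv_sum_squares[of "{2..n}" "u a" y a] dual by auto
    then show ?thesis using a n
      by (simp add: F_def dderiv_mult dderiv_add dual Q)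
  qed
  have T': "a \<noteq> 0" "a \<noteq> Suc 0" "a \<noteq> n" "n \<noteq> a" if "a \<in> T" for a
    using that T by auto
  have n': "Suc 0 \<le> n" "n \<noteq> 0" "n \<noteq> Suc 0" "Suc 0 \<noteq> n" using n by auto
  note D_simps = DF dderiv_mult dderiv_add dual T T' n'
  have "enat (\<Sum>j<4. card (P j)) \<le> srk n 4 F"
  proof (rule apolar_bound[where J = T and z = n and e = n and \<kappa> = 1 and u = u])
    fix j ws vs assume "j < 4" and P: "(ws, vs) \<in> P j"
    show "length ws = 4 - j \<and> length vs = j"
      using \<open>j < 4\<close> P by (cases rule: less_4_cases) (auto simp: P_def)
    show "(\<exists>a\<in>T. \<exists>r. ws = a # r) \<or> (\<exists>r. ws = n # n # r) \<or>
        (\<exists>r. ws = n # r) \<and> dderiv (u n) (dderiv (u n) F) = 0"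
      using \<open>j < 4\<close> P by (cases rule: less_4_cases) (auto simp: P_def)
    show "fold (\<lambda>i. dderiv (u i)) (ws @ vs) F \<noteq> 0"
      using \<open>j < 4\<close> P by (cases rule: less_4_cases) (auto simp: P_def D_simps)
    fix ws' vs' assume "(ws', vs') \<in> P j" "(ws, vs) \<noteq> (ws', vs')"
    with \<open>j < 4\<close> P show "fold (\<lambda>i. dderiv (u i)) (ws @ vs') F = 0"
      by (cases rule: less_4_cases) (auto simp: P_def D_simps)
  qed (use T in \<open>auto simp: D_simps P_def\<close>)
  also have "(\<Sum>j<4. card (P j)) = 4 * (n - 1)"
  proof -
    have "card (P 0) = 1" by (simp add: P_def)
    moreover have "card (P 1) = 2 + (n - 2)"
      unfolding P_def using T n' by (auto simp: card_insert_if card_image inj_on_def)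
    moreover have "card (P 2) = 1 + 2 * (n - 2)"
      unfolding P_def using T n'
      by (auto simp: card_insert_if card_Un_images inj_on_def)
    moreover have "card (P 3) = n - 2"
      unfolding P_def using T by (simp add: card_image inj_on_def) 
    ultimately show ?thesis using n by (simp add: eval_nat_numeral)
  qed
  finally show ?thesis unfolding F_def .
qed

lemma srk_ge_double_hyperplane:
  fixes y :: "nat \<Rightarrow> 'k::field_char_0 mpol" and u :: "nat \<Rightarrow> nat \<Rightarrow> 'k"
  assumes n: "n \<ge> 2"
    and dual: "\<And>i j. i \<le> n \<Longrightarrow> j \<le> n \<Longrightarrow> dderiv (u i) (y j) = of_bool (i = j)"
    and Q: "\<And>i. i \<in> {1..n} \<Longrightarrow> dderiv (u i) Q = 0"
  shows "enat (3 * n) \<le> srk n 4 ((y 0)\<^sup>2 * ((\<Sum>i=1..n. (y i)\<^sup>2) + Q))"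
proof -
  define F where "F = (y 0)\<^sup>2 * ((\<Sum>i=1..n. (y i)\<^sup>2) + Q)"
  define T where "T = {1..<n}"
  \<comment> \<open>Direction \<open>n\<close> again serves as \<open>z\<close> and
    \<open>e\<close>. The cardinalities are 1, n, n and n - 1.\<close>
  define P :: "nat \<Rightarrow> (nat list \<times> nat list) set" where "P = (\<lambda>j.
    if j = 0 then {([n, n, 0, 0], [])}
    else if j = 1 then {([n, n, 0], [0])} \<union> (\<lambda>a. ([a, 0, 0], [a])) ` T
    else if j = 2 then {([n, n], [0, 0])} \<union> (\<lambda>a. ([a, 0], [0, a])) ` T
    else (\<lambda>a. ([a], [0, 0, a])) ` T)"
  have T: "finite T" "card T = n - 1" "n \<notin> T" "0 \<notin> T" "T \<noteq> {}" "a \<in> T \<Longrightarrow> a \<le> n" for a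
    using n by (auto simp: T_def)
  have DF: "dderiv (u a) F = 2 * ((y 0)\<^sup>2 * y a)" if "a \<in> insert n T" for a
  proof -
    have a: "1 \<le> a" "a \<le> n" using that n by (auto simp: T_def)
    then have "dderiv (u a) (\<Sum>i=1..n. (y i)\<^sup>2) = 2 * y a"
      using dderiv_sum_squares[of "{1..n}" "u a" y a] dual by auto
    then show ?thesis using a n
      by (simp add: F_def dderiv_mult dderiv_square dderiv_add dual Q)
  qed
  have T': "a \<noteq> 0" "a \<noteq> n" "n \<noteq> a" if "a \<in> T" for a
    using that T by auto
  have n': "n \<noteq> 0" using n by auto
  note D_simps = DF dderiv_mult dderiv_square dderiv_add dual T T' n'
  have "enat (\<Sum>j<4. card (P j)) \<le> srk n 4 F"
  proof (rule apolar_bound[where J = T and z = n and e = n and \<kappa> = 1 and u = u])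
    fix j ws vs assume "j < 4" and P: "(ws, vs) \<in> P j"
    show "length ws = 4 - j \<and> length vs = j"
      using \<open>j < 4\<close> P by (cases rule: less_4_cases) (auto simp: P_def)
    show "(\<exists>a\<in>T. \<exists>r. ws = a # r) \<or> (\<exists>r. ws = n # n # r) \<or>
        (\<exists>r. ws = n # r) \<and> dderiv (u n) (dderiv (u n) F) = 0"
      using \<open>j < 4\<close> P by (cases rule: less_4_cases) (auto simp: P_def)
    show "fold (\<lambda>i. dderiv (u i)) (ws @ vs) F \<noteq> 0"
      using \<open>j < 4\<close> P by (cases rule: less_4_cases) (auto simp: P_def D_simps)
    fix ws' vs' assume "(ws', vs') \<in> P j" "(ws, vs) \<noteq> (ws', vs')"
    with \<open>j < 4\<close> P show "fold (\<lambda>i. dderiv (u i)) (ws @ vs') F = 0"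
      by (cases rule: less_4_cases) (auto simp: P_def D_simps)
  qed (use T in \<open>auto simp: D_simps P_def\<close>)
  also have "(\<Sum>j<4. card (P j)) = 3 * n"
  proof -
    have "card (P 0) = 1" by (simp add: P_def)
    moreover have "card (P 1) = 1 + (n - 1)" "card (P 2) = 1 + (n - 1)" "card (P 3) = n - 1"
      unfolding P_def using T n' by (auto simp: card_insert_if card_image inj_on_def)
    ultimately show ?thesis using n by (simp add: eval_nat_numeral)
  qed
  finally show ?thesis unfolding F_def .
qed

text \<open>The coordinate \<open>y 1\<close> occurs linearly and serves as \<open>z\<close>. As the
  second derivative in its direction is 0, every list headed by 1 is admissible, also for
  \<open>j = 3\<close>; the cardinalities are 1, n, n and n.\<close>

lemma srk_ge_tangent_double_hyperplane:
  fixes y :: "nat \<Rightarrow> 'k::field_char_0 mpol" and u :: "nat \<Rightarrow> nat \<Rightarrow> 'k"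
  assumes n: "n \<ge> 2"
    and dual: "\<And>i j. i \<le> n \<Longrightarrow> j \<le> n \<Longrightarrow> dderiv (u i) (y j) = of_bool (i = j)"
  shows "enat (3 * n + 1) \<le> srk n 4 ((y 0)\<^sup>2 * (y 0 * y 1 + (\<Sum>i=2..n. (y i)\<^sup>2)))"
proof -
  define F where "F = (y 0)\<^sup>2 * (y 0 * y 1 + (\<Sum>i=2..n. (y i)\<^sup>2))"
  define T where "T = {2..n}"
  define P :: "nat \<Rightarrow> (nat list \<times> nat list) set" where "P = (\<lambda>j.
    if j = 0 then {([1, 0, 0, 0], [])}
    else if j = 1 then {([1, 0, 0], [0])} \<union> (\<lambda>a. ([a, 0, 0], [a])) ` T
    else if j = 2 then {([1, 0], [0, 0])} \<union> (\<lambda>a. ([a, 0], [0, a])) ` T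
    else {([1], [0, 0, 0])} \<union> (\<lambda>a. ([a], [0, 0, a])) ` T)"
  have T: "finite T" "card T = n - 1" "Suc 0 \<notin> T" "0 \<notin> T" "T \<noteq> {}" "a \<in> T \<Longrightarrow> a \<le> n" for a
    using n by (auto simp: T_def)
  have DF: "dderiv (u a) F = 2 * ((y 0)\<^sup>2 * y a)" if "a \<in> T" for a
  proof -
    have a: "2 \<le> a" "a \<le> n" using that n by (auto simp: T_def)
    then have "dderiv (u a) (\<Sum>i=2..n. (y i)\<^sup>2) = 2 * y a"
      using dderiv_sum_squares[of "{2..n}" "u a" y a] dual by auto
    then show ?thesis using a n
      by (simp add: F_def dderiv_mult dderiv_square dderiv_add dual)
  qed
  have DF1: "dderiv (u (Suc 0)) F = (y 0)\<^sup>2 * y 0"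
  proof -
    have "dderiv (u (Suc 0)) (\<Sum>i=2..n. (y i)\<^sup>2) = 0"
      using dderiv_sum_squares[of "{2..n}" "u 1" y 1] dual n by auto
    then show ?thesis using n
      by (simp add: F_def dderiv_mult dderiv_square dderiv_add dual)
  qed
  have T': "a \<noteq> 0" "a \<noteq> Suc 0" "Suc 0 \<noteq> a" if "a \<in> T" for a
    using that T by auto
  have n': "Suc 0 \<le> n" using n by auto
  note D_simps = DF DF1 dderiv_mult dderiv_square dderiv_add dual T T' n'
  have "enat (\<Sum>j<4. card (P j)) \<le> srk n 4 F"
  \<comment> \<open>\<open>2 / 3\<close> compares the second derivative \<open>2 * (y 0)^2\<close>
    in the direction of a square with the mixed derivative \<open>3 * (y 0)^2\<close> in directions
    0 and 1.\<close>
  proof (rule apolar_bound[where J = T and z = 1 and e = 0 and \<kappa> = "2 / 3" and u = u])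
    fix j ws vs assume "j < 4" and P: "(ws, vs) \<in> P j"
    show "length ws = 4 - j \<and> length vs = j"
      using \<open>j < 4\<close> P by (cases rule: less_4_cases) (auto simp: P_def)
    show "(\<exists>a\<in>T. \<exists>r. ws = a # r) \<or> (\<exists>r. ws = 1 # 0 # r) \<or>
        (\<exists>r. ws = 1 # r) \<and> dderiv (u 1) (dderiv (u 1) F) = 0"
      using \<open>j < 4\<close> P by (cases rule: less_4_cases) (auto simp: P_def D_simps)
    show "fold (\<lambda>i. dderiv (u i)) (ws @ vs) F \<noteq> 0"
      using \<open>j < 4\<close> P by (cases rule: less_4_cases) (auto simp: P_def D_simps)
    fix ws' vs' assume "(ws', vs') \<in> P j" "(ws, vs) \<noteq> (ws', vs')"
    with \<open>j < 4\<close> P show "fold (\<lambda>i. dderiv (u i)) (ws @ vs') F = 0"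
      by (cases rule: less_4_cases) (auto simp: P_def D_simps)
  next
    fix a assume a: "a \<in> T"
    have "dderiv (u 0) (dderiv (u 1) F) = 3 * (y 0)\<^sup>2"
      by (simp add: D_simps power2_eq_square)
    moreover have "scale (2 / 3 :: 'k) (3 * (y 0)\<^sup>2) = 2 * (y 0)\<^sup>2"
      by (simp add: scale_def mult_single flip: single_numeral mult.assoc)
    moreover have "dderiv (u a) (dderiv (u a) F) = 2 * (y 0)\<^sup>2"
      using a by (simp add: D_simps)
    ultimately show "dderiv (u a) (dderiv (u a) F) = scale (2 / 3) (dderiv (u 0) (dderiv (u 1) F))"
      by (simp only:)
  qed (use T in \<open>auto simp: D_simps P_def\<close>)
  also have "(\<Sum>j<4. card (P j)) = 3 * n + 1"
  proof -
    have "card (P 0) = 1" by (simp add: P_def)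
    moreover have "card (P 1) = 1 + (n - 1)" "card (P 2) = 1 + (n - 1)" "card (P 3) = 1 + (n - 1)"
      unfolding P_def using T n' by (auto simp: card_insert_if card_image inj_on_def)
    ultimately show ?thesis using n by (simp add: eval_nat_numeral)
  qed
  finally show ?thesis unfolding F_def .
qed

text \<open>Now \<open>y 2\<close> occurs linearly and serves as \<open>z\<close>, with
  \<open>e = 1\<close>. The cardinalities are 1, n, 2n - 2 and n - 1. The bound coincides with the
  upper bound in \<open>srk_le_tangent_secant\<close>.\<close>

lemma srk_ge_tangent_secant:
  fixes y :: "nat \<Rightarrow> 'k::field_char_0 mpol" and u :: "nat \<Rightarrow> nat \<Rightarrow> 'k"
  assumes n: "n \<ge> 3"
    and dual: "\<And>i j. i \<le> n \<Longrightarrow> j \<le> n \<Longrightarrow> dderiv (u i) (y j) = of_bool (i = j)"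
    and Q: "\<And>i. i \<in> {2..n} \<Longrightarrow> dderiv (u i) Q = 0"
  shows "enat (4 * (n - 1) + 2) \<le> srk n 4 (y 0 * y 1 * (y 1 * y 2 + (\<Sum>i=3..n. (y i)\<^sup>2) + Q))"
proof -
  define F where "F = y 0 * y 1 * (y 1 * y 2 + (\<Sum>i=3..n. (y i)\<^sup>2) + Q)"
  define T where "T = {3..n}"
  define P :: "nat \<Rightarrow> (nat list \<times> nat list) set" where "P = (\<lambda>j.
    if j = 0 then {([2, 0, 1, 1], [])}
    else if j = 1 then {([2, 0, 1], [1]), ([2, 1, 1], [0])} \<union> (\<lambda>a. ([a, 0, 1], [a])) ` T
    else if j = 2 then {([2, 0], [1, 1]), ([2, 1], [0, 1])} \<union>
      ((\<lambda>a. ([a, 1], [0, a])) ` T \<union> (\<lambda>a. ([a, 0], [1, a])) ` T)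
    else {([2], [0, 1, 1])} \<union> (\<lambda>a. ([a], [0, 1, a])) ` T)"
  have T: "finite T" "card T = n - 2" "2 \<notin> T" "Suc 0 \<notin> T" "0 \<notin> T" "T \<noteq> {}" "a \<in> T \<Longrightarrow> a \<le> n" for a
    using n by (auto simp: T_def)
  have n': "Suc 0 \<le> n" "2 \<le> n" using n by auto
  have DF: "dderiv (u a) F = 2 * (y 0 * y 1 * y a)" if "a \<in> T" for a
  proof -
    have a: "3 \<le> a" "a \<le> n" using that n by (auto simp: T_def)
    then have "dderiv (u a) (\<Sum>i=3..n. (y i)\<^sup>2) = 2 * y a"
      using dderiv_sum_squares[of "{3..n}" "u a" y a] dual by auto
    then show ?thesis using a n n'
      by (simp add: F_def dderiv_mult dderiv_add dual Q)
  qed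
  have DF2: "dderiv (u 2) F = y 0 * y 1 * y 1"
  proof -
    have "dderiv (u 2) (\<Sum>i=3..n. (y i)\<^sup>2) = 0"
      using dderiv_sum_squares[of "{3..n}" "u 2" y 2] dual n by auto
    then show ?thesis using n n'
      by (simp add: F_def dderiv_mult dderiv_add dual Q)
  qed
  have T': "a \<noteq> 0" "a \<noteq> Suc 0" "Suc 0 \<noteq> a" "a \<noteq> 2" "2 \<noteq> a" if "a \<in> T" for a
    using that T by auto
  note D_simps = DF DF2 dderiv_mult dderiv_add dual T T' n'
  have "enat (\<Sum>j<4. card (P j)) \<le> srk n 4 F"
  proof (rule apolar_bound[where J = T and z = 2 and e = 1 and \<kappa> = 1 and u = u])
    fix j ws vs assume "j < 4" and P: "(ws, vs) \<in> P j"
    show "length ws = 4 - j \<and> length vs = j"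
      using \<open>j < 4\<close> P by (cases rule: less_4_cases) (auto simp: P_def)
    show "(\<exists>a\<in>T. \<exists>r. ws = a # r) \<or> (\<exists>r. ws = 2 # 1 # r) \<or>
        (\<exists>r. ws = 2 # r) \<and> dderiv (u 2) (dderiv (u 2) F) = 0"
      using \<open>j < 4\<close> P by (cases rule: less_4_cases) (auto simp: P_def D_simps)
    show "fold (\<lambda>i. dderiv (u i)) (ws @ vs) F \<noteq> 0"
      using \<open>j < 4\<close> P by (cases rule: less_4_cases) (auto simp: P_def D_simps)
    fix ws' vs' assume "(ws', vs') \<in> P j" "(ws, vs) \<noteq> (ws', vs')"
    with \<open>j < 4\<close> P show "fold (\<lambda>i. dderiv (u i)) (ws @ vs') F = 0"
      by (cases rule: less_4_cases) (auto simp: P_def D_simps)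
  qed (use T in \<open>auto simp: D_simps P_def\<close>)
  also have "(\<Sum>j<4. card (P j)) = 4 * (n - 1) + 2"
  proof -
    have "card (P 0) = 1" by (simp add: P_def)
    moreover have "card (P 1) = 2 + (n - 2)" "card (P 3) = 1 + (n - 2)"
      unfolding P_def using T n' by (auto simp: card_insert_if card_image inj_on_def)
    moreover have "card (P 2) = 2 + 2 * (n - 2)"
      unfolding P_def using T n' by (auto simp: card_insert_if card_Un_images inj_on_def)
    ultimately show ?thesis using n by (simp add: eval_nat_numeral)
  qed
  finally show ?thesis unfolding F_def .
qed

section \<open>Decompositions\<close>

abbreviation power_span :: "nat \<Rightarrow> 'k::field mpol set \<Rightarrow> 'k mpol set"
  where "power_span d S \<equiv> mpol.span ((\<lambda>m. m ^ d) ` S)"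

lemma power_span_base: "m \<in> S \<Longrightarrow> m ^ d \<in> power_span d S"
  by (rule mpol.span_base) blast

lemma power_span_mono: "F \<in> power_span d S \<Longrightarrow> S \<subseteq> S' \<Longrightarrow> F \<in> power_span d S'"
  by (meson image_mono mpol.span_mono subsetD)

lemma scale_power: "(scale c p) ^ k = scale (c ^ k) (p ^ k)"
  by (induction k) (simp_all add: scale_def single_mult_0 mult_ac)

lemma self_mem_proj_point: "m \<in> proj_point m"
  unfolding proj_point_def by (auto intro!: exI[of _ 1])

lemma proj_point_eqD: "proj_point m = proj_point m' \<Longrightarrow> \<exists>c. c \<noteq> 0 \<and> m = scale c m'"
  using self_mem_proj_point[of m] by (auto simp: proj_point_def)

text \<open>One representative is chosen for each point. Proportional forms have proportional powers
  and the form 0 has power 0, so the representatives span the same powers; passing to points can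
  only shorten the list.\<close>

lemma symmetric_decomposition_power_span:
  assumes S: "finite S" "S \<subseteq> linear_forms n" and F: "F \<in> power_span d S" and d: "d > 0"
  shows "symmetric_decomposition n d F (proj_point ` (S - {0}))"
proof -
  define Z where "Z = proj_point ` (S - {0})"
  define r where "r = inv_into (S - {0}) proj_point"
  have r: "r z \<in> S - {0}" "proj_point (r z) = z" if "z \<in> Z" for z
    using that inv_into_into[of z proj_point "S - {0}"] f_inv_into_f[of z proj_point "S - {0}"]
    by (auto simp: Z_def r_def)
  define M where "M = r ` Z"
  have bij: "bij_betw proj_point M Z"
    unfolding M_def bij_betw_def inj_on_def by (auto simp: r image_image)
  have sub: "M \<subseteq> S - {0}" unfolding M_def using r by auto
  have mem: "m ^ d \<in> power_span d M" if m: "m \<in> S" for m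
  proof (cases "m = 0")
    case True
    then show ?thesis using d by (simp add: mpol.span_zero zero_power)
  next
    case False
    then have z: "proj_point m \<in> Z" using m by (auto simp: Z_def)
    obtain c where "m = scale c (r (proj_point m))"
      using proj_point_eqD[of m "r (proj_point m)"] r(2)[OF z] by metis
    then have "m ^ d = scale (c ^ d) (r (proj_point m) ^ d)"
      by (metis scale_power)
    also have "\<dots> \<in> power_span d M"
      by (intro mpol.span_scale power_span_base) (auto simp: M_def z)
    finally show ?thesis .
  qed
  have "power_span d S \<subseteq> power_span d M"
    by (rule mpol.span_minimal) (auto simp: mem mpol.subspace_span)
  with F have "F \<in> power_span d M" by blast
  then show ?thesis
    unfolding symmetric_decomposition_def proj_linear_forms_def
    using S bij sub by (intro conjI exI[of _ M]) (auto simp: Z_def)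
qed

lemma card_proj_points_le: "finite S \<Longrightarrow> card (proj_point ` (S - {0})) \<le> card S"
  by (meson card_image_le card_mono Diff_subset finite_Diff order_trans)

lemma srk_le: "symmetric_decomposition n d F Z \<Longrightarrow> srk n d F \<le> enat (card Z)"
  unfolding srk_def by (rule INF_lower) simp

lemma srk_le_card:
  assumes "finite S" "S \<subseteq> linear_forms n" "F \<in> power_span d S" "d > 0" "card S \<le> k"
  shows "srk n d F \<le> enat k"
proof -
  have "srk n d F \<le> enat (card (proj_point ` (S - {0})))"
    by (intro srk_le symmetric_decomposition_power_span assms)
  also have "\<dots> \<le> enat k"
    using card_proj_points_le[OF assms(1)] assms(5) by simp
  finally show ?thesis .
qed

lemma linear_forms_add: "p \<in> linear_forms n \<Longrightarrow> q \<in> linear_forms n \<Longrightarrow> p + q \<in> linear_forms n"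
  and linear_forms_diff: "p \<in> linear_forms n \<Longrightarrow> q \<in> linear_forms n \<Longrightarrow> p - q \<in> linear_forms n"
  and linear_forms_scale: "p \<in> linear_forms n \<Longrightarrow> scale c p \<in> linear_forms n"
  and linear_forms_Var: "i \<le> n \<Longrightarrow> Var i \<in> linear_forms n"
  unfolding linear_forms_def
  by (auto intro: mpol.span_add mpol.span_diff mpol.span_scale mpol.span_base)

lemmas linear_forms_intros = linear_forms_add linear_forms_diff linear_forms_scale linear_forms_Var

section \<open>Sums of nonzero squares with prescribed value\<close>

lemma ex_sqrt: "\<exists>r. r\<^sup>2 = (c :: 'k::alg_closed_field)"
  using nth_root_exists[of 2 c] by auto

text \<open>The value at \<open>i\<close> is a free parameter, the value at \<open>j\<close> is
  solved for, and the other \<open>card I - 2\<close> values are 1. The condition on the square of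
  \<open>r\<close> keeps the solved value nonzero.\<close>

lemma ex_nonzero_square_sum:
  fixes r c :: "'k::alg_closed_field"
  assumes I: "finite I" "i \<in> I" "j \<in> I" "i \<noteq> j"
    and r: "r \<noteq> 0" "r\<^sup>2 \<noteq> c - of_nat (card I - 2)"
  shows "\<exists>p. p i = r \<and> (\<forall>k\<in>I. p k \<noteq> 0) \<and> (\<Sum>k\<in>I. (p k)\<^sup>2) = c"
proof -
  obtain s where s: "s\<^sup>2 = c - of_nat (card I - 2) - r\<^sup>2" using ex_sqrt by blast
  define p where "p = (\<lambda>k. if k = i then r else if k = j then s else 1)"
  have "s \<noteq> 0" using s r(2) by auto
  have "(\<Sum>k\<in>I. (p k)\<^sup>2) = (p i)\<^sup>2 + ((p j)\<^sup>2 + (\<Sum>k\<in>I - {i} - {j}. (p k)\<^sup>2))"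
    using I sum.remove[of I i "\<lambda>k. (p k)\<^sup>2"] sum.remove[of "I - {i}" j "\<lambda>k. (p k)\<^sup>2"] by simp
  also have "(\<Sum>k\<in>I - {i} - {j}. (p k)\<^sup>2) = (\<Sum>k\<in>I - {i} - {j}. 1)"
    by (rule sum.cong) (auto simp: p_def)
  also have "\<dots> = of_nat (card I - 2)"
    using I by (simp add: numeral_2_eq_2)
  finally have "(\<Sum>k\<in>I. (p k)\<^sup>2) = c" using I s by (simp add: p_def)
  then show ?thesis using r(1) \<open>s \<noteq> 0\<close> by (intro exI[of _ p]) (auto simp: p_def)
qed

lemma finite_sqrts: "finite {r. r\<^sup>2 = (c :: 'k::field)}"
proof -
  have "finite {r. poly [:- c, 0, 1:] r = 0}" by (rule poly_roots_finite) simp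
  then show ?thesis by (simp add: power2_eq_square algebra_simps eq_neg_iff_add_eq_0)
qed

lemma infinite_nonzero_nonsqrt:
  fixes c :: "'k::field_char_0"
  shows "infinite {r. r \<noteq> 0 \<and> r\<^sup>2 \<noteq> c}"
proof -
  have "infinite (UNIV - ({0} \<union> {r. r\<^sup>2 = c}))"
    by (rule Diff_infinite_finite) (use finite_sqrts infinite_UNIV_char_0 in auto)
  then show ?thesis by (rule infinite_super[rotated]) auto
qed

lemma ex_nonzero_square_sum':
  fixes c :: "'k::{alg_closed_field, field_char_0}"
  assumes "finite I" "card I \<ge> 2"
  shows "\<exists>p. (\<forall>k\<in>I. p k \<noteq> 0) \<and> (\<Sum>k\<in>I. (p k)\<^sup>2) = c"
proof -
  obtain i j where "i \<in> I" "j \<in> I" "i \<noteq> j"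
    using assms(2) by (metis card_2_iff' obtain_subset_with_card_n subset_iff)
  moreover obtain r :: 'k where "r \<noteq> 0" "r\<^sup>2 \<noteq> c - of_nat (card I - 2)"
    using infinite_nonzero_nonsqrt[of "c - of_nat (card I - 2)"] not_finite_existsD by blast
  ultimately show ?thesis using ex_nonzero_square_sum assms(1) by metis
qed

lemma scale_numeral: "scale (numeral k) p = numeral k * p"
  by (simp add: scale_def)

lemma numeral_power_span: "F \<in> power_span d S \<Longrightarrow> numeral k * F \<in> power_span d S"
  by (metis mpol.span_scale scale_numeral)

lemmas power_span_intros = mpol.span_add mpol.span_diff mpol.span_scale numeral_power_span power_span_base

section \<open>Decompositions for two distinct hyperplanes\<close>

definition secant_points :: "'k::field mpol \<Rightarrow> 'k mpol \<Rightarrow> 'k mpol \<Rightarrow> 'k \<Rightarrow> 'k \<Rightarrow> 'k mpol set"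
  where "secant_points a b y p q =
    {scale p a + scale q b + y, scale p a + scale q b - y,
     scale p a - scale q b + y, scale p a - scale q b - y}"

text \<open>Summing over the sign of \<open>y\<close> and alternating over the sign of
  \<open>b\<close> leaves the monomials even in \<open>y\<close> and odd in \<open>b\<close>. These
  are \<open>a * b * y^2\<close>, \<open>a^3 * b\<close> and \<open>a * b^3\<close>, with
  coefficients 48, 16 and 16 up to powers of \<open>p\<close> and \<open>q\<close>; the quotient 16
  / 48 explains the thirds.\<close>

lemma secant_points_power_span:
  fixes a b y :: "'k::field_char_0 mpol"
  assumes "p \<noteq> 0" "q \<noteq> 0"
  shows "a * b * (y\<^sup>2 + scale (p\<^sup>2 / 3) (a\<^sup>2) + scale (q\<^sup>2 / 3) (b\<^sup>2)) \<in> power_span 4 (secant_points a b y p q)"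
proof -
  define P where "P = Poly_Mapping.single (0 :: nat \<Rightarrow>\<^sub>0 nat) p"
  define Q where "Q = Poly_Mapping.single (0 :: nat \<Rightarrow>\<^sub>0 nat) q"
  have id: "(P * a + Q * b + y) ^ 4 + (P * a + Q * b - y) ^ 4 - (P * a - Q * b + y) ^ 4 - (P * a - Q * b - y) ^ 4 =
      48 * P * Q * (a * b * y\<^sup>2) + 16 * P * Q * (a * b * (P\<^sup>2 * a\<^sup>2 + Q\<^sup>2 * b\<^sup>2))"
    by algebra
  let ?G = "a * b * (y\<^sup>2 + scale (p\<^sup>2 / 3) (a\<^sup>2) + scale (q\<^sup>2 / 3) (b\<^sup>2))"
  have "scale (48 * p * q) ?G = 48 * P * Q * (a * b * y\<^sup>2) + 16 * P * Q * (a * b * (P\<^sup>2 * a\<^sup>2 + Q\<^sup>2 * b\<^sup>2))"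
  proof -
    have third: "3 * scale (c / 3) x = scale c x" for c and x :: "'k mpol"
      by (simp flip: scale_numeral)
    have "scale (48 * p * q) ?G = 48 * P * Q * ?G"
      by (simp add: scale_def single_mult_0 P_def Q_def)
    also have "\<dots> = 48 * P * Q * (a * b * y\<^sup>2) +
        16 * P * Q * (a * b * (3 * scale (p\<^sup>2 / 3) (a\<^sup>2) + 3 * scale (q\<^sup>2 / 3) (b\<^sup>2)))"
      by algebra
    also have "3 * scale (p\<^sup>2 / 3) (a\<^sup>2) + 3 * scale (q\<^sup>2 / 3) (b\<^sup>2) = P\<^sup>2 * a\<^sup>2 + Q\<^sup>2 * b\<^sup>2"
      unfolding third by (simp add: scale_def single_mult_0 P_def Q_def power2_eq_square)
    finally show ?thesis .
  qed
  also have "\<dots> \<in> power_span 4 (secant_points a b y p q)"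
    unfolding id[symmetric] unfolding P_def Q_def scale_def[symmetric]
    by (intro power_span_intros) (auto simp: secant_points_def)
  finally have "scale (inverse (48 * p * q)) (scale (48 * p * q) ?G) \<in> power_span 4 (secant_points a b y p q)"
    by (rule mpol.span_scale)
  then show ?thesis using assms by (simp add: field_simps)
qed

lemma sum_secant_points_power_span:
  fixes a b :: "'k::field_char_0 mpol"
  assumes "\<And>i. i \<in> I \<Longrightarrow> p i \<noteq> 0" "\<And>i. i \<in> I \<Longrightarrow> q i \<noteq> 0"
    and "(\<Sum>i\<in>I. (p i)\<^sup>2) = 3 * \<mu>" "(\<Sum>i\<in>I. (q i)\<^sup>2) = 3 * \<nu>"
  shows "a * b * ((\<Sum>i\<in>I. (y i)\<^sup>2) + (scale \<mu> (a\<^sup>2) + scale \<nu> (b\<^sup>2)))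
    \<in> power_span 4 (\<Union>i\<in>I. secant_points a b (y i) (p i) (q i))"
proof -
  have sq: "(\<Sum>i\<in>I. scale ((r i)\<^sup>2 / 3) x) = scale c x" if "(\<Sum>i\<in>I. (r i)\<^sup>2) = 3 * c" for r c and x :: "'k mpol"
    using that by (simp flip: mpol.scale_sum_left sum_divide_distrib)
  have "a * b * ((\<Sum>i\<in>I. (y i)\<^sup>2) + (scale \<mu> (a\<^sup>2) + scale \<nu> (b\<^sup>2))) =
      a * b * (\<Sum>i\<in>I. (y i)\<^sup>2 + scale ((p i)\<^sup>2 / 3) (a\<^sup>2) + scale ((q i)\<^sup>2 / 3) (b\<^sup>2))"
    by (simp add: sum.distrib sq[OF assms(3)] sq[OF assms(4)] add.assoc)
  also have "\<dots> = (\<Sum>i\<in>I. a * b * ((y i)\<^sup>2 + scale ((p i)\<^sup>2 / 3) (a\<^sup>2) + scale ((q i)\<^sup>2 / 3) (b\<^sup>2)))"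
    by (rule sum_distrib_left)
  also have "\<dots> \<in> power_span 4 (\<Union>i\<in>I. secant_points a b (y i) (p i) (q i))"
    by (intro mpol.span_sum power_span_mono[OF secant_points_power_span] assms(1,2)) auto
  finally show ?thesis .
qed

lemma finite_secant_points: "finite (secant_points a b y p q)"
  and card_secant_points: "card (secant_points a b y p q) \<le> 4"
  by (simp_all add: secant_points_def card_insert_if)

lemma secant_points_linear_forms:
  "a \<in> linear_forms n \<Longrightarrow> b \<in> linear_forms n \<Longrightarrow> y \<in> linear_forms n \<Longrightarrow>
    secant_points a b y p q \<subseteq> linear_forms n"
  by (auto simp: secant_points_def intro!: linear_forms_intros)

lemma card_UN_secant_points:
  assumes "finite I"
  shows "card (\<Union>i\<in>I. secant_points a b (y i) (p i) (q i)) \<le> 4 * card I"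
proof -
  have "card (\<Union>i\<in>I. secant_points a b (y i) (p i) (q i)) \<le> (\<Sum>i\<in>I. card (secant_points a b (y i) (p i) (q i)))"
    by (rule card_UN_le[OF assms])
  also have "\<dots> \<le> (\<Sum>i\<in>I. 4)" by (intro sum_mono card_secant_points)
  finally show ?thesis by simp
qed

lemma srk_le_secant:
  fixes y :: "nat \<Rightarrow> 'k::{alg_closed_field, field_char_0} mpol"
  assumes y: "\<And>i. i \<le> n \<Longrightarrow> y i \<in> linear_forms n" and n: "n \<ge> 3"
  shows "srk n 4 (y 0 * y 1 * ((\<Sum>i=2..n. (y i)\<^sup>2) + (scale \<mu> ((y 0)\<^sup>2) + scale \<nu> ((y 1)\<^sup>2)))) \<le> enat (4 * (n - 1))"
proof -
  have "card {2..n} \<ge> 2" using n by simp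
  obtain p where p: "\<forall>i\<in>{2..n}. p i \<noteq> 0" "(\<Sum>i=2..n. (p i)\<^sup>2) = 3 * \<mu>"
    using ex_nonzero_square_sum'[OF finite_atLeastAtMost \<open>card {2..n} \<ge> 2\<close>] by metis
  obtain q where q: "\<forall>i\<in>{2..n}. q i \<noteq> 0" "(\<Sum>i=2..n. (q i)\<^sup>2) = 3 * \<nu>"
    using ex_nonzero_square_sum'[OF finite_atLeastAtMost \<open>card {2..n} \<ge> 2\<close>] by metis
  show ?thesis
  proof (rule srk_le_card)
    show "y 0 * y 1 * ((\<Sum>i=2..n. (y i)\<^sup>2) + (scale \<mu> ((y 0)\<^sup>2) + scale \<nu> ((y 1)\<^sup>2)))
        \<in> power_span 4 (\<Union>i\<in>{2..n}. secant_points (y 0) (y 1) (y i) (p i) (q i))"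
      using p q by (intro sum_secant_points_power_span) auto
    show "(\<Union>i\<in>{2..n}. secant_points (y 0) (y 1) (y i) (p i) (q i)) \<subseteq> linear_forms n"
      using y n by (intro UN_least secant_points_linear_forms) auto
    show "card (\<Union>i\<in>{2..n}. secant_points (y 0) (y 1) (y i) (p i) (q i)) \<le> 4 * (n - 1)"
      using card_UN_secant_points[of "{2..n}" "y 0" "y 1" y p q] by simp
  qed (simp_all add: finite_secant_points)
qed

lemma srk_add_le:
  assumes F: "srk n d F \<le> enat k" and S: "finite S" "S \<subseteq> linear_forms n" "G \<in> power_span d S" "d > 0"
  shows "srk n d (F + G) \<le> enat (k + card S)"
proof -
  obtain Z where Z: "symmetric_decomposition n d F Z" "enat (card Z) \<le> enat k"
  proof -
    \<comment> \<open>The infimum is tested by a strict inequality, hence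
      \<open>Suc k\<close>.\<close>
    have "\<exists>Z. symmetric_decomposition n d F Z \<and> enat (card Z) < enat (Suc k)"
      using order.strict_trans1[OF F, of "enat (Suc k)"]
      by (auto simp: srk_def INF_less_iff)
    then show ?thesis using that by auto
  qed
  then obtain M where M: "finite Z" "M \<subseteq> linear_forms n - {0}" "bij_betw proj_point M Z" "F \<in> power_span d M"
    by (auto simp: symmetric_decomposition_def)
  have M': "finite M" "card M \<le> k"
    using M Z(2) bij_betw_finite[OF M(3)] bij_betw_same_card[OF M(3)] by auto
  show ?thesis
  proof (rule srk_le_card)
    show "F + G \<in> power_span d (M \<union> S)"
      using M(4) S(3) by (intro mpol.span_add) (auto elim: power_span_mono)
    show "card (M \<union> S) \<le> k + card S"
      using card_Un_le[of M S] M'(2) by simp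
  qed (use S M M' in auto)
qed

text \<open>Two further points supply the term in \<open>a^2 * b^2\<close>. With
  \<open>i^2 = -1\<close>, the pure powers cancel in the difference of the fourth powers of
  \<open>a + b\<close> and \<open>a + i * b\<close>. The terms in \<open>a^3 * b\<close> and
  \<open>a * b^3\<close> that come along are compensated by replacing \<open>\<alpha>\<close> and
  \<open>\<gamma>\<close> by \<open>\<mu>\<close> and \<open>\<nu>\<close>.\<close>

lemma srk_le_secant_mixed:
  fixes y :: "nat \<Rightarrow> 'k::{alg_closed_field, field_char_0} mpol"
  assumes y: "\<And>i. i \<le> n \<Longrightarrow> y i \<in> linear_forms n" and n: "n \<ge> 3"
  shows "srk n 4 (y 0 * y 1 * ((\<Sum>i=2..n. (y i)\<^sup>2) +
      (scale \<alpha> ((y 0)\<^sup>2) + scale \<beta> (y 0 * y 1) + scale \<gamma> ((y 1)\<^sup>2)))) \<le> enat (4 * (n - 1) + 2)"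
proof -
  obtain i where i: "i\<^sup>2 = (- 1 :: 'k)" using ex_sqrt by blast
  define J where "J = Poly_Mapping.single (0 :: nat \<Rightarrow>\<^sub>0 nat) i"
  define B where "B = Poly_Mapping.single (0 :: nat \<Rightarrow>\<^sub>0 nat) (\<beta> / 12)"
  let ?a = "y 0" and ?b = "y 1"
  define S where "S = {?a + ?b, ?a + scale i ?b}"
  define G where "G = scale (\<beta> / 12) ((?a + ?b) ^ 4 - (?a + scale i ?b) ^ 4)"
  define \<mu> where "\<mu> = \<alpha> - \<beta> / 12 * (4 * (1 - i))"
  define \<nu> where "\<nu> = \<gamma> - \<beta> / 12 * (4 * (1 + i))"
  have J: "J * J = - 1"
    using i by (simp add: J_def mult_single power2_eq_square single_uminus)
  have "(?a + ?b) ^ 4 - (?a + J * ?b) ^ 4 =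
      12 * (?a\<^sup>2 * ?b\<^sup>2) + 4 * (1 - J) * (?a ^ 3 * ?b) + 4 * (1 + J) * (?a * ?b ^ 3)"
    using J by algebra
  then have G: "G = B * (12 * (?a\<^sup>2 * ?b\<^sup>2) + 4 * (1 - J) * (?a ^ 3 * ?b) + 4 * (1 + J) * (?a * ?b ^ 3))"
    by (simp add: G_def B_def J_def scale_def)
  have \<beta>: "scale \<beta> x = 12 * B * x" for x :: "'k mpol"
    by (simp add: B_def scale_def mult_single flip: single_numeral)
  have \<mu>: "scale \<alpha> x = scale \<mu> x + 4 * B * (1 - J) * x" for x :: "'k mpol"
  proof -
    have "Poly_Mapping.single 0 \<alpha> = Poly_Mapping.single 0 \<mu> + B * (4 * (1 - J))"
      unfolding \<mu>_def single_diff single_mult_0 by (simp add: B_def J_def single_diff)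
    then show ?thesis unfolding scale_def by algebra
  qed
  have \<nu>: "scale \<gamma> x = scale \<nu> x + 4 * B * (1 + J) * x" for x :: "'k mpol"
  proof -
    have "Poly_Mapping.single 0 \<gamma> = Poly_Mapping.single 0 \<nu> + B * (4 * (1 + J))"
      unfolding \<nu>_def single_diff single_mult_0 by (simp add: B_def J_def single_add)
    then show ?thesis unfolding scale_def by algebra
  qed
  have "?a * ?b * ((\<Sum>i=2..n. (y i)\<^sup>2) + (scale \<alpha> (?a\<^sup>2) + scale \<beta> (?a * ?b) + scale \<gamma> (?b\<^sup>2))) =
      ?a * ?b * ((\<Sum>i=2..n. (y i)\<^sup>2) + (scale \<mu> (?a\<^sup>2) + scale \<nu> (?b\<^sup>2))) + G"
    unfolding \<mu> \<nu> \<beta> G by algebra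
  also have "srk n 4 \<dots> \<le> enat (4 * (n - 1) + card S)"
  proof (rule srk_add_le)
    show "S \<subseteq> linear_forms n" using y n by (auto simp: S_def intro!: linear_forms_intros)
    show "G \<in> power_span 4 S"
      unfolding G_def by (intro power_span_intros) (auto simp: S_def)
  qed (use srk_le_secant[OF y n] in \<open>auto simp: S_def\<close>)
  also have "\<dots> \<le> enat (4 * (n - 1) + 2)"
    by (simp add: S_def card_insert_if)
  finally show ?thesis .
qed

section \<open>Decompositions for double hyperplanes\<close>

text \<open>
  The values 6, 3, -2 have second elementary symmetric function 0. This is what makes the
  coefficients of \<open>a\<^sup>3 y\<close>, \<open>a y\<^sup>3\<close> and \<open>y\<^sup>4\<close> vanish in a suitable combination of the fourth powers.
\<close>
definition double_hyperplane_points :: "'k::field mpol \<Rightarrow> 'k mpol \<Rightarrow> 'k \<Rightarrow> 'k mpol set"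
  where "double_hyperplane_points a y s = {scale s a + 6 * y, scale s a + 3 * y, scale s a - 2 * y}"

lemma double_hyperplane_points_power_span:
  fixes a y :: "'k::field_char_0 mpol"
  assumes "s \<noteq> 0"
  shows "a\<^sup>2 * (y\<^sup>2 + scale (7 / 216 * s\<^sup>2) (a\<^sup>2)) \<in> power_span 4 (double_hyperplane_points a y s)"
proof -
  define P where "P = Poly_Mapping.single (0 :: nat \<Rightarrow>\<^sub>0 nat) s"
  \<comment> \<open>The weights 64, 81, -5 solve the three vanishing conditions. The constant
    \<open>7 / 216\<close> is the quotient 140 / 4320 of the surviving coefficients.\<close>
  have id: "64 * (P * a + 3 * y) ^ 4 + 81 * (P * a - 2 * y) ^ 4 - 5 * (P * a + 6 * y) ^ 4 =
      4320 * P\<^sup>2 * (a\<^sup>2 * y\<^sup>2) + 140 * P ^ 4 * a ^ 4"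
    by algebra
  let ?G = "a\<^sup>2 * (y\<^sup>2 + scale (7 / 216 * s\<^sup>2) (a\<^sup>2))"
  have "4320 * scale (7 / 216 * s\<^sup>2) (a\<^sup>2) = 140 * P\<^sup>2 * a\<^sup>2"
  proof -
    have "4320 * scale (7 / 216 * s\<^sup>2) (a\<^sup>2) = scale (140 * s\<^sup>2) (a\<^sup>2)"
      by (simp flip: scale_numeral)
    then show ?thesis by (simp add: scale_def single_mult_0 P_def power2_eq_square)
  qed
  then have "4320 * P\<^sup>2 * ?G = 4320 * P\<^sup>2 * (a\<^sup>2 * y\<^sup>2) + 140 * P ^ 4 * a ^ 4"
    by algebra
  moreover have "scale (4320 * s\<^sup>2) x = 4320 * P\<^sup>2 * x" for x
    by (simp add: scale_def single_mult_0 P_def power2_eq_square)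
  ultimately have "scale (4320 * s\<^sup>2) ?G = 64 * (P * a + 3 * y) ^ 4 + 81 * (P * a - 2 * y) ^ 4 - 5 * (P * a + 6 * y) ^ 4"
    unfolding id by simp
  also have "\<dots> \<in> power_span 4 (double_hyperplane_points a y s)"
    unfolding P_def scale_def[symmetric]
    by (intro power_span_intros) (auto simp: double_hyperplane_points_def)
  finally have "scale (inverse (4320 * s\<^sup>2)) (scale (4320 * s\<^sup>2) ?G) \<in> power_span 4 (double_hyperplane_points a y s)"
    by (rule mpol.span_scale)
  then show ?thesis using assms by (simp add: field_simps)
qed

lemma linear_forms_numeral: "p \<in> linear_forms n \<Longrightarrow> numeral k * p \<in> linear_forms n"
  by (metis linear_forms_scale scale_numeral)

lemma ex_double_hyperplane_decomposition:
  fixes y :: "nat \<Rightarrow> 'k::{alg_closed_field, field_char_0} mpol"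
  assumes y: "a \<in> linear_forms n" "\<And>i. i \<in> I \<Longrightarrow> y i \<in> linear_forms n" and I: "finite I" "card I \<ge> 2"
  shows "\<exists>S. finite S \<and> S \<subseteq> linear_forms n \<and> card S \<le> 3 * card I \<and>
    a\<^sup>2 * ((\<Sum>i\<in>I. (y i)\<^sup>2) + scale c (a\<^sup>2)) \<in> power_span 4 S"
proof -
  obtain s where s: "\<forall>i\<in>I. s i \<noteq> 0" "(\<Sum>i\<in>I. (s i)\<^sup>2) = 216 / 7 * c"
    using ex_nonzero_square_sum'[OF I] by metis
  define S where "S = (\<Union>i\<in>I. double_hyperplane_points a (y i) (s i))"
  have "(\<Sum>i\<in>I. scale (7 / 216 * (s i)\<^sup>2) (a\<^sup>2)) = scale c (a\<^sup>2)"
    unfolding mpol.scale_sum_left[symmetric] sum_distrib_left[symmetric] s(2) by simp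
  then have "a\<^sup>2 * ((\<Sum>i\<in>I. (y i)\<^sup>2) + scale c (a\<^sup>2)) =
      (\<Sum>i\<in>I. a\<^sup>2 * ((y i)\<^sup>2 + scale (7 / 216 * (s i)\<^sup>2) (a\<^sup>2)))"
    by (simp add: sum.distrib flip: sum_distrib_left)
  also have "\<dots> \<in> power_span 4 S"
    using s(1) by (intro mpol.span_sum power_span_mono[OF double_hyperplane_points_power_span]) (auto simp: S_def)
  finally have "a\<^sup>2 * ((\<Sum>i\<in>I. (y i)\<^sup>2) + scale c (a\<^sup>2)) \<in> power_span 4 S" .
  moreover have "S \<subseteq> linear_forms n"
    using y by (auto simp: S_def double_hyperplane_points_def intro!: linear_forms_intros linear_forms_numeral)
  moreover have "card S \<le> 3 * card I"
  proof -
    have "card S \<le> (\<Sum>i\<in>I. card (double_hyperplane_points a (y i) (s i)))"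
      unfolding S_def by (rule card_UN_le[OF I(1)])
    also have "\<dots> \<le> (\<Sum>i\<in>I. 3)"
      by (intro sum_mono) (simp add: double_hyperplane_points_def card_insert_if)
    finally show ?thesis by simp
  qed
  moreover have "finite S" using I(1) by (simp add: S_def double_hyperplane_points_def)
  ultimately show ?thesis by blast
qed

lemma srk_le_double_hyperplane:
  fixes y :: "nat \<Rightarrow> 'k::{alg_closed_field, field_char_0} mpol"
  assumes y: "\<And>i. i \<le> n \<Longrightarrow> y i \<in> linear_forms n" and n: "n \<ge> 2"
  shows "srk n 4 ((y 0)\<^sup>2 * ((\<Sum>i=1..n. (y i)\<^sup>2) + scale c ((y 0)\<^sup>2))) \<le> enat (3 * n)"
proof -
  obtain S where "finite S" "S \<subseteq> linear_forms n" "card S \<le> 3 * card {1..n}"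
    "(y 0)\<^sup>2 * ((\<Sum>i=1..n. (y i)\<^sup>2) + scale c ((y 0)\<^sup>2)) \<in> power_span 4 S"
    using ex_double_hyperplane_decomposition[of "y 0" n "{1..n}" y c] y n by auto
  then show ?thesis by (intro srk_le_card) auto
qed

text \<open>The n - 1 squares take three points each, and the binary quartic \<open>a^3 * b\<close>
  takes four more.\<close>

lemma srk_le_tangent_double_hyperplane:
  fixes y :: "nat \<Rightarrow> 'k::{alg_closed_field, field_char_0} mpol"
  assumes y: "\<And>i. i \<le> n \<Longrightarrow> y i \<in> linear_forms n" and n: "n \<ge> 3"
  shows "srk n 4 ((y 0)\<^sup>2 * (y 0 * y 1 + (\<Sum>i=2..n. (y i)\<^sup>2))) \<le> enat (3 * n + 1)"
proof -
  let ?a = "y 0" and ?b = "y 1"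
  have "card {2..n} \<ge> 2" using n by simp
  then obtain S where S: "finite S" "S \<subseteq> linear_forms n" "card S \<le> 3 * card {2..n}"
    "?a\<^sup>2 * ((\<Sum>i=2..n. (y i)\<^sup>2) + scale 0 (?a\<^sup>2)) \<in> power_span 4 S"
    using ex_double_hyperplane_decomposition[of ?a n "{2..n}" y 0] y by (metis atLeastAtMost_iff finite_atLeastAtMost zero_le)
  define T where "T = {?a + ?b, ?a - ?b, ?a + 2 * ?b, ?a - 2 * ?b}"
  \<comment> \<open>The difference of the fourth powers of \<open>a + t * b\<close> and
    \<open>a - t * b\<close> involves only \<open>a^3 * b\<close> and \<open>a * b^3\<close>.
    Weights 8 for \<open>t = 1\<close> and -1 for \<open>t = 2\<close> cancel the latter.\<close>
  have "48 * (?a ^ 3 * ?b) = 8 * (?a + ?b) ^ 4 - 8 * (?a - ?b) ^ 4 - (?a + 2 * ?b) ^ 4 + (?a - 2 * ?b) ^ 4"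
    by algebra
  also have "\<dots> \<in> power_span 4 T"
    by (intro power_span_intros) (auto simp: T_def)
  finally have "scale (1 / 48) (scale 48 (?a ^ 3 * ?b)) \<in> power_span 4 T"
    unfolding scale_numeral by (rule mpol.span_scale)
  then have T: "?a ^ 3 * ?b \<in> power_span 4 T" by simp
  have eq: "?a\<^sup>2 * (?a * ?b + (\<Sum>i=2..n. (y i)\<^sup>2)) = ?a\<^sup>2 * ((\<Sum>i=2..n. (y i)\<^sup>2) + scale 0 (?a\<^sup>2)) + ?a ^ 3 * ?b"
    unfolding scale_simps by algebra
  have "srk n 4 (?a\<^sup>2 * (?a * ?b + (\<Sum>i=2..n. (y i)\<^sup>2))) \<le> enat (3 * card {2..n} + card T)"
    unfolding eq
  proof (rule srk_add_le[OF srk_le_card[OF S(1,2,4) _ S(3)]])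
    show "T \<subseteq> linear_forms n"
      using y n by (auto simp: T_def intro!: linear_forms_intros linear_forms_numeral)
    show "?a ^ 3 * ?b \<in> power_span 4 T" by (rule T)
  qed (simp_all add: T_def)
  also have "\<dots> \<le> enat (3 * n + 1)"
  proof -
    have "card T \<le> 4" unfolding T_def by (intro card_insert_le_m1) simp_all
    then have "3 * card {2..n} + card T \<le> 3 * n + 1" using n unfolding card_atLeastAtMost by linarith
    then show ?thesis by simp
  qed
  finally show ?thesis .
qed

text \<open>For n = 3 only one square is left, so sums of squares cannot be prescribed freely.
  Instead \<open>p = 2\<close> and \<open>q = 1\<close> are used throughout, which fixes
  \<open>\<mu>\<close> and \<open>\<nu>\<close>. The remaining ternary quartic takes six points; the
  condition on \<open>c\<close> says that its coefficient \<open>\<kappa>\<close> of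
  \<open>a^3 * b\<close> is nonzero.\<close>

lemma srk_le_tangent_secant:
  fixes y :: "nat \<Rightarrow> 'k::{alg_closed_field, field_char_0} mpol"
  assumes y: "\<And>i. i \<le> n \<Longrightarrow> y i \<in> linear_forms n" and n: "n \<ge> 3"
    and c: "3 * c \<noteq> 4 * of_nat (n - 2)"
  shows "srk n 4 (y 0 * y 1 * (y 1 * y 2 + (\<Sum>i=3..n. (y i)\<^sup>2) + scale c ((y 0)\<^sup>2))) \<le> enat (4 * (n - 1) + 2)"
proof -
  let ?a = "y 0" and ?b = "y 1" and ?z = "y 2"
  define \<mu> :: 'k where "\<mu> = 4 * of_nat (n - 2) / 3"
  define \<nu> :: 'k where "\<nu> = of_nat (n - 2) / 3"
  define \<kappa> where "\<kappa> = c - \<mu>"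
  have \<kappa>: "\<kappa> \<noteq> 0" using c by (simp add: \<kappa>_def \<mu>_def field_simps)
  define U where "U = (\<Union>i\<in>{3..n}. secant_points ?a ?b (y i) 2 1)"
  have U: "?a * ?b * ((\<Sum>i=3..n. (y i)\<^sup>2) + (scale \<mu> (?a\<^sup>2) + scale \<nu> (?b\<^sup>2))) \<in> power_span 4 U"
    unfolding U_def using n
    by (intro sum_secant_points_power_span[where p = "\<lambda>_. 2" and q = "\<lambda>_. 1"])
      (simp_all add: \<mu>_def \<nu>_def numeral_2_eq_2 numeral_3_eq_3)
  have "\<exists>w. poly [:1, - 1, 1:] w = (0::'k)"
    by (rule alg_closed_imp_poly_has_root) simp
  then obtain w' :: 'k where "1 + w' * (- 1 + w' * 1) = 0"
    by auto
  then have w': "w' * w' = w' - 1" by algebra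
  define w where "w = Poly_Mapping.single (0 :: nat \<Rightarrow>\<^sub>0 nat) w'"
  have w: "w * w = w - 1"
    by (simp add: w_def mult_single w' single_diff)
  define K where "K = Poly_Mapping.single (0 :: nat \<Rightarrow>\<^sub>0 nat) \<kappa>"
  define K' where "K' = Poly_Mapping.single (0 :: nat \<Rightarrow>\<^sub>0 nat) (1 / (3 * \<kappa>))"
  have K: "3 * K * K' = 1"
    using \<kappa> by (simp add: K_def K'_def mult_single flip: single_numeral)
  \<comment> \<open>The shift by \<open>\<nu>\<close> absorbs the surplus term in
    \<open>a * b^3\<close>, and \<open>K'\<close> adjusts the ratio of the two remaining monomials
    to the ratio 3 : 1 that the six points produce.\<close>
  define z where "z = K' * (?z - scale \<nu> ?b)"
  define V where "V = {?b + ?a + z, ?b - ?a + z, ?b + w * ?a + (w - 1) * z, ?b - w * ?a + (w - 1) * z,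
      ?b + (w - 1) * ?a - w * z, ?b - (w - 1) * ?a - w * z}"
  \<comment> \<open>The six forms are \<open>b + w\<^sup>k a + w\<^bsup>2k\<^esup> z\<close> for a primitive sixth root of unity \<open>w\<close>. In the alternating
    sum of their fourth powers only the monomials of weight 3 remain, where \<open>a\<close>, \<open>b\<close>, \<open>z\<close> have
    weights 1, 0, 2.\<close>
  have id: "72 * (?a * ?b\<^sup>2 * z) + 24 * (?a ^ 3 * ?b) = (?b + ?a + z) ^ 4 - (?b - ?a + z) ^ 4
      - (?b + w * ?a + (w - 1) * z) ^ 4 + (?b - w * ?a + (w - 1) * z) ^ 4
      + (?b + (w - 1) * ?a - w * z) ^ 4 - (?b - (w - 1) * ?a - w * z) ^ 4"
    using w by algebra
  have "72 * (?a * ?b\<^sup>2 * z) + 24 * (?a ^ 3 * ?b) \<in> power_span 4 V"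
    unfolding id by (intro power_span_intros) (auto simp: V_def)
  then have "scale (\<kappa> / 24) (72 * (?a * ?b\<^sup>2 * z) + 24 * (?a ^ 3 * ?b)) \<in> power_span 4 V"
    by (rule mpol.span_scale)
  also have "scale (\<kappa> / 24) (72 * (?a * ?b\<^sup>2 * z) + 24 * (?a ^ 3 * ?b)) = 3 * K * (?a * ?b\<^sup>2 * z) + K * (?a ^ 3 * ?b)"
  proof -
    have "72 * (?a * ?b\<^sup>2 * z) + 24 * (?a ^ 3 * ?b) = scale 24 (3 * (?a * ?b\<^sup>2 * z) + ?a ^ 3 * ?b)"
      unfolding scale_numeral by algebra
    then have "scale (\<kappa> / 24) (72 * (?a * ?b\<^sup>2 * z) + 24 * (?a ^ 3 * ?b)) = K * (3 * (?a * ?b\<^sup>2 * z) + ?a ^ 3 * ?b)"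
      by (simp add: K_def scale_def[of \<kappa>])
    then show ?thesis by algebra
  qed
  also have "\<dots> = ?a * ?b\<^sup>2 * (?z - scale \<nu> ?b) + K * (?a ^ 3 * ?b)"
    unfolding z_def using K by algebra
  finally have V: "?a * ?b\<^sup>2 * (?z - scale \<nu> ?b) + K * (?a ^ 3 * ?b) \<in> power_span 4 V" .
  have c_eq: "scale c x = scale \<mu> x + K * x" for x :: "'k mpol"
    unfolding K_def scale_def \<kappa>_def single_diff by algebra
  have eq: "?a * ?b * (?b * ?z + (\<Sum>i=3..n. (y i)\<^sup>2) + scale c (?a\<^sup>2)) =
      ?a * ?b * ((\<Sum>i=3..n. (y i)\<^sup>2) + (scale \<mu> (?a\<^sup>2) + scale \<nu> (?b\<^sup>2))) +
      (?a * ?b\<^sup>2 * (?z - scale \<nu> ?b) + K * (?a ^ 3 * ?b))"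
    unfolding c_eq scale_def[of \<nu>] by algebra
  have "srk n 4 (?a * ?b * (?b * ?z + (\<Sum>i=3..n. (y i)\<^sup>2) + scale c (?a\<^sup>2))) \<le> enat (4 * card {3..n} + card V)"
    unfolding eq
  proof (rule srk_add_le[OF srk_le_card[where S = U]])
    show "finite U" by (simp add: U_def finite_secant_points)
    show "U \<subseteq> linear_forms n"
      unfolding U_def using y n by (intro UN_least secant_points_linear_forms) auto
    show "card U \<le> 4 * card {3..n}"
      unfolding U_def by (rule card_UN_secant_points) simp
    have "z \<in> linear_forms n"
      unfolding z_def K'_def scale_def[symmetric] using y n by (intro linear_forms_intros) auto
    then have "?b \<in> linear_forms n" "?a \<in> linear_forms n" "z \<in> linear_forms n" "w * x = scale w' x"
      "(w - 1) * x = scale (w' - 1) x" for x :: "'k mpol"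
      using y n by (simp_all add: w_def scale_def single_diff)
    then show "V \<subseteq> linear_forms n"
      by (auto simp: V_def intro!: linear_forms_intros)
    show "finite V" by (simp add: V_def)
  qed (rule U V zero_less_numeral)+
  also have "\<dots> \<le> enat (4 * (n - 1) + 2)"
  proof -
    have "card V \<le> 6" unfolding V_def by (intro card_insert_le_m1) simp_all
    then have "4 * card {3..n} + card V \<le> 4 * (n - 1) + 2" using n unfolding card_atLeastAtMost by linarith
    then show ?thesis by simp
  qed
  finally show ?thesis .
qed

text \<open>The free parameter \<open>r\<close> in the sum of squares is varied. Each admissible
  \<open>r\<close> puts the point of \<open>m r\<close> into some decomposition of the given length.
  These points are distinct, whereas finitely many decompositions would contain only finitely many
  points.\<close>

lemma infinite_secant_decompositions:
  fixes y :: "nat \<Rightarrow> 'k::{alg_closed_field, field_char_0} mpol" and u :: "nat \<Rightarrow> nat \<Rightarrow> 'k"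
  assumes n: "n \<ge> 3" and y: "\<And>i. i \<le> n \<Longrightarrow> y i \<in> linear_forms n"
    and dual: "\<And>i j. i \<le> n \<Longrightarrow> j \<le> n \<Longrightarrow> dderiv (u i) (y j) = of_bool (i = j)"
  shows "infinite {Z. symmetric_decomposition n 4
      (y 0 * y 1 * ((\<Sum>i=2..n. (y i)\<^sup>2) + (scale \<mu> ((y 0)\<^sup>2) + scale \<nu> ((y 1)\<^sup>2)))) Z \<and> card Z = 4 * (n - 1)}"
    (is "infinite {Z. symmetric_decomposition n 4 ?F Z \<and> _}")
proof
  assume fin: "finite {Z. symmetric_decomposition n 4 ?F Z \<and> card Z = 4 * (n - 1)}" (is "finite ?D")
  have card2: "card {2..n} \<ge> 2" using n by simp
  obtain q where q: "\<forall>i\<in>{2..n}. q i \<noteq> 0" "(\<Sum>i=2..n. (q i)\<^sup>2) = 3 * \<nu>"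
    using ex_nonzero_square_sum'[OF finite_atLeastAtMost card2] by metis
  define R where "R = {r. r \<noteq> 0 \<and> r\<^sup>2 \<noteq> 3 * \<mu> - of_nat (card {2..n} - 2)}"
  define m where "m = (\<lambda>r. scale r (y 0) + scale (q 2) (y 1) + y 2)"
  have ge: "enat (4 * (n - 1)) \<le> srk n 4 ?F"
  proof (rule srk_ge_secant[OF n dual])
    show "dderiv (u i) (scale \<mu> ((y 0)\<^sup>2) + scale \<nu> ((y 1)\<^sup>2)) = 0" if "i \<in> {2..n}" for i
      using that n by (simp add: dderiv_add dderiv_scale dderiv_square dual)
  qed
  have lower: "4 * (n - 1) \<le> card Z" if "symmetric_decomposition n 4 ?F Z" for Z
    using order_trans[OF ge srk_le[OF that]] by simp
  have dm: "dderiv (u 2) (m r) = 1" "dderiv (u 0) (m r) = Poly_Mapping.single 0 r" for r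
    using n by (simp_all add: m_def dderiv_add dderiv_scale dual) (simp_all add: scale_def)
  have mem: "proj_point (m r) \<in> \<Union>?D" if r: "r \<in> R" for r
  proof -
    obtain p where p: "p 2 = r" "\<forall>i\<in>{2..n}. p i \<noteq> 0" "(\<Sum>i=2..n. (p i)\<^sup>2) = 3 * \<mu>"
      using ex_nonzero_square_sum[of "{2..n}" 2 3 r "3 * \<mu>"] r n by (auto simp: R_def)
    define S where "S = (\<Union>i\<in>{2..n}. secant_points (y 0) (y 1) (y i) (p i) (q i))"
    have S: "finite S" "S \<subseteq> linear_forms n" "card S \<le> 4 * (n - 1)"
    proof -
      show "finite S" by (simp add: S_def finite_secant_points)
      show "S \<subseteq> linear_forms n"
        unfolding S_def using y n by (intro UN_least secant_points_linear_forms) auto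
      show "card S \<le> 4 * (n - 1)"
        unfolding S_def using card_UN_secant_points[of "{2..n}" "y 0" "y 1" y p q] by simp
    qed
    define Z where "Z = proj_point ` (S - {0})"
    have Z: "symmetric_decomposition n 4 ?F Z"
      unfolding Z_def
    proof (rule symmetric_decomposition_power_span[OF S(1,2)])
      show "?F \<in> power_span 4 S"
        unfolding S_def using p q by (intro sum_secant_points_power_span) auto
    qed simp
    \<comment> \<open>The construction gives at most this many points, and the lower bound on the
      rank excludes any coincidence among them.\<close>
    have "card Z = 4 * (n - 1)"
      using lower[OF Z] S(3) card_proj_points_le[OF S(1)] by (simp add: Z_def)
    moreover have "m r \<in> S"
      unfolding S_def using n p(1) by (intro UN_I[of 2]) (auto simp: m_def secant_points_def)
    moreover have "m r \<noteq> 0" using dm(1)[of r] by auto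
    ultimately show ?thesis using Z by (auto simp: Z_def)
  qed
  have "finite (\<Union>?D)"
    using fin by (auto simp: symmetric_decomposition_def)
  then have "finite ((\<lambda>r. proj_point (m r)) ` R)"
    by (rule finite_subset[rotated]) (use mem in blast)
  moreover have "inj_on (\<lambda>r. proj_point (m r)) R"
  proof
    fix r r' assume "proj_point (m r) = proj_point (m r')"
    then obtain c where c: "m r = scale c (m r')" using proj_point_eqD by blast
    \<comment> \<open>Both forms have coefficient 1 at \<open>y 2\<close>, which forces
      \<open>c = 1\<close>; the coefficient at \<open>y 0\<close> then recovers
      \<open>r\<close>.\<close>
    have "scale c 1 = (1 :: 'k mpol)"
      using arg_cong[OF c, of "dderiv (u 2)"] by (simp add: dderiv_scale dm)
    from arg_cong[OF this, of "\<lambda>p. Poly_Mapping.lookup p 0"] have "c = 1"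
      by (simp add: scale_def)
    then have "Poly_Mapping.single 0 r = (Poly_Mapping.single 0 r' :: 'k mpol)"
      using arg_cong[OF c, of "dderiv (u 0)"] by (simp add: dm)
    then show "r = r'" by (metis lookup_single_eq)
  qed
  ultimately have "finite R" by (simp add: finite_image_iff)
  then show False using infinite_nonzero_nonsqrt unfolding R_def by blast
qed

section \<open>The ranks of the reducible quartics\<close>

lemma dderiv_diff: "dderiv v (p - q) = dderiv v p - dderiv v q"
  using dderiv_add[of v "p - q" q] by (simp add: algebra_simps)

lemma srk_eq_secant:
  fixes y :: "nat \<Rightarrow> 'k::{alg_closed_field, field_char_0} mpol" and u :: "nat \<Rightarrow> nat \<Rightarrow> 'k"
  assumes n: "n \<ge> 3" and y: "\<And>i. i \<le> n \<Longrightarrow> y i \<in> linear_forms n"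
    and dual: "\<And>i j. i \<le> n \<Longrightarrow> j \<le> n \<Longrightarrow> dderiv (u i) (y j) = of_bool (i = j)"
  shows "srk n 4 (y 0 * y 1 * ((\<Sum>i=2..n. (y i)\<^sup>2) + (scale \<mu> ((y 0)\<^sup>2) + scale \<nu> ((y 1)\<^sup>2)))) = enat (4 * (n - 1))"
proof (rule antisym[OF srk_le_secant[OF y n] srk_ge_secant[OF n dual]])
  show "dderiv (u i) (scale \<mu> ((y 0)\<^sup>2) + scale \<nu> ((y 1)\<^sup>2)) = 0" if "i \<in> {2..n}" for i
    using that n by (simp add: dderiv_add dderiv_scale dderiv_square dual)
qed

lemma srk_bounds_secant_mixed:
  fixes y :: "nat \<Rightarrow> 'k::{alg_closed_field, field_char_0} mpol" and u :: "nat \<Rightarrow> nat \<Rightarrow> 'k"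
  assumes n: "n \<ge> 3" and y: "\<And>i. i \<le> n \<Longrightarrow> y i \<in> linear_forms n"
    and dual: "\<And>i j. i \<le> n \<Longrightarrow> j \<le> n \<Longrightarrow> dderiv (u i) (y j) = of_bool (i = j)"
    and F: "F = y 0 * y 1 * ((\<Sum>i=2..n. (y i)\<^sup>2) +
      (scale \<alpha> ((y 0)\<^sup>2) + scale \<beta> (y 0 * y 1) + scale \<gamma> ((y 1)\<^sup>2)))"
  shows "enat (4 * (n - 1)) \<le> srk n 4 F \<and> srk n 4 F \<le> enat (4 * (n - 1) + 2)"
  unfolding F
proof (rule conjI[OF srk_ge_secant[OF n dual] srk_le_secant_mixed[OF y n]])
  show "dderiv (u i) (scale \<alpha> ((y 0)\<^sup>2) + scale \<beta> (y 0 * y 1) + scale \<gamma> ((y 1)\<^sup>2)) = 0" if "i \<in> {2..n}" for i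
    using that n by (simp add: dderiv_add dderiv_mult dderiv_scale dderiv_square dual)
qed

theorem theorem4p8:
  fixes n :: nat
    and x :: "nat \<Rightarrow> 'k::{alg_closed_field, field_char_0} mpol"
  defines "x \<equiv> Var"
  assumes n: "n \<ge> 3"
  shows
    "(srk n 4 ((x 0)^2 * (\<Sum>i=0..n. (x i)^2)) = enat (3 * n)) \<and>
     (srk n 4 ((x 0)^2 * (\<Sum>i=1..n. (x i)^2)) = enat (3 * n)) \<and>
     (srk n 4 ((x 0)^2 * (x 0 * x 1 + (\<Sum>i=2..n. (x i)^2))) = enat (3 * n + 1)) \<and>
     (srk n 4 (x 0 * x 1 * (\<Sum>i=2..n. (x i)^2)) = enat (4 * (n - 1))) \<and>
     (enat (4 * (n - 1)) \<le> srk n 4 (x 0 * x 1 * (x 1 * x 2 + (\<Sum>i=3..n. (x i)^2))) \<and>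
         srk n 4 (x 0 * x 1 * (x 1 * x 2 + (\<Sum>i=3..n. (x i)^2))) \<le> enat (4 * (n - 1) + 2)) \<and>
     (srk n 4 (x 0 * x 1 * (\<Sum>i=1..n. (x i)^2)) = enat (4 * (n - 1))) \<and>
     (enat (4 * (n - 1)) \<le> srk n 4 (x 0 * (x 0 + x 1) * (\<Sum>i=1..n. (x i)^2)) \<and>
         srk n 4 (x 0 * (x 0 + x 1) * (\<Sum>i=1..n. (x i)^2)) \<le> enat (4 * (n - 1) + 2)) \<and>
     (\<forall>l::'k. l \<noteq> 0 \<longrightarrow>
         enat (4 * (n - 1)) \<le> srk n 4 (x 0 * (scale l (x 0) + x 1) * (\<Sum>i=0..n. (x i)^2)) \<and>
         srk n 4 (x 0 * (scale l (x 0) + x 1) * (\<Sum>i=0..n. (x i)^2)) \<le> enat (4 * (n - 1) + 2)) \<and>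
     (srk n 4 (x 0 * x 1 * (\<Sum>i=0..n. (x i)^2)) = enat (4 * (n - 1))) \<and>
     (enat (4 * (n - 1)) \<le> srk n 4 (x 0 * x 1 * ((x 0)^2 + x 1 * x 2 + (\<Sum>i=3..n. (x i)^2))) \<and>
         srk n 4 (x 0 * x 1 * ((x 0)^2 + x 1 * x 2 + (\<Sum>i=3..n. (x i)^2))) \<le> enat (4 * (n - 1) + 2)) \<and>
     (\<forall>l::'k.
         enat (4 * (n - 1)) \<le> srk n 4 (x 0 * (scale (- (l^2)) (x 0) + x 1 + scale l (x 2)) *
                                  (x 0 * x 1 + (\<Sum>i=2..n. (x i)^2))) \<and>
         srk n 4 (x 0 * (scale (- (l^2)) (x 0) + x 1 + scale l (x 2)) *
                                  (x 0 * x 1 + (\<Sum>i=2..n. (x i)^2))) \<le> enat (4 * (n - 1) + 2)) \<and>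
     (infinite {Z. symmetric_decomposition n 4 (x 0 * x 1 * (\<Sum>i=2..n. (x i)^2)) Z \<and>
                      card Z = 4 * (n - 1)}) \<and>
     (infinite {Z. symmetric_decomposition n 4 (x 0 * x 1 * (\<Sum>i=1..n. (x i)^2)) Z \<and>
                      card Z = 4 * (n - 1)}) \<and>
     (infinite {Z. symmetric_decomposition n 4 (x 0 * x 1 * (\<Sum>i=0..n. (x i)^2)) Z \<and>
                      card Z = 4 * (n - 1)})"
proof -
  define e :: "nat \<Rightarrow> nat \<Rightarrow> 'k" where "e = (\<lambda>i j. of_bool (i = j))"
  have const: "of_bool b = Poly_Mapping.single (0 :: nat \<Rightarrow>\<^sub>0 nat) (of_bool b :: 'k)" for b
    by (cases b) simp_all
  have D: "dderiv v (x j) = Poly_Mapping.single 0 (v j)" for v j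
    by (simp add: x_def dderiv_Var)
  have dual: "dderiv (e i) (x j) = of_bool (i = j)" for i j
    unfolding D const by (simp add: e_def)
  have scale_const: "scale c (Poly_Mapping.single 0 d) = (Poly_Mapping.single 0 (c * d) :: 'k mpol)" for c d
    by (simp add: scale_def mult_single)
  have x_lin: "x i \<in> linear_forms n" if "i \<le> n" for i
    using that by (simp add: x_def linear_forms_Var)
  have sum0: "(\<Sum>i=0..n. (x i)\<^sup>2) = (x 0)\<^sup>2 + (\<Sum>i=1..n. (x i)\<^sup>2)"
    using sum.atLeast_Suc_atMost[of 0 n "\<lambda>i. (x i)\<^sup>2"] by simp
  have sum1: "(\<Sum>i=1..n. (x i)\<^sup>2) = (x 1)\<^sup>2 + (\<Sum>i=2..n. (x i)\<^sup>2)"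
    using sum.atLeast_Suc_atMost[of 1 n "\<lambda>i. (x i)\<^sup>2"] n by (simp add: numeral_2_eq_2)
  have sum2: "(\<Sum>i=2..n. (x i)\<^sup>2) = (x 2)\<^sup>2 + (\<Sum>i=3..n. (x i)\<^sup>2)"
    using sum.atLeast_Suc_atMost[of 2 n "\<lambda>i. (x i)\<^sup>2"] n by (simp add: numeral_3_eq_3 numeral_2_eq_2)
  \<comment> \<open>In these three quartics the quadric has no mixed term \<open>x 0 * x 1\<close>,
    so no points beyond the secant ones are required.\<close>
  have nsecant: "x 0 * x 1 * (\<Sum>i=2..n. (x i)\<^sup>2) =
      x 0 * x 1 * ((\<Sum>i=2..n. (x i)\<^sup>2) + (scale 0 ((x 0)\<^sup>2) + scale 0 ((x 1)\<^sup>2)))"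
    "x 0 * x 1 * (\<Sum>i=1..n. (x i)\<^sup>2) =
      x 0 * x 1 * ((\<Sum>i=2..n. (x i)\<^sup>2) + (scale 0 ((x 0)\<^sup>2) + scale 1 ((x 1)\<^sup>2)))"
    "x 0 * x 1 * (\<Sum>i=0..n. (x i)\<^sup>2) =
      x 0 * x 1 * ((\<Sum>i=2..n. (x i)\<^sup>2) + (scale 1 ((x 0)\<^sup>2) + scale 1 ((x 1)\<^sup>2)))"
    unfolding sum0 sum1 scale_simps by algebra+
  have n2: "n \<ge> 2" using n by simp
  have double_hyperplane: "srk n 4 ((x 0)\<^sup>2 * ((\<Sum>i=1..n. (x i)\<^sup>2) + scale c ((x 0)\<^sup>2))) = enat (3 * n)" for c
  proof (rule antisym[OF srk_le_double_hyperplane[OF x_lin n2] srk_ge_double_hyperplane[OF n2 dual]])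
    show "dderiv (e i) (scale c ((x 0)\<^sup>2)) = 0" if "i \<in> {1..n}" for i
      using that by (simp add: dderiv_scale dderiv_square dual)
  qed
  have "srk n 4 ((x 0)\<^sup>2 * (\<Sum>i=0..n. (x i)\<^sup>2)) = enat (3 * n)"
    using double_hyperplane[of 1] by (simp only: sum0 scale_simps add.commute)
  moreover have "srk n 4 ((x 0)\<^sup>2 * (\<Sum>i=1..n. (x i)\<^sup>2)) = enat (3 * n)"
    using double_hyperplane[of 0] by (simp only: scale_simps add_0_right)
  moreover have "srk n 4 ((x 0)\<^sup>2 * (x 0 * x 1 + (\<Sum>i=2..n. (x i)\<^sup>2))) = enat (3 * n + 1)"
    by (rule antisym[OF srk_le_tangent_double_hyperplane[OF x_lin n] srk_ge_tangent_double_hyperplane[OF n2 dual]])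
  moreover have "srk n 4 (x 0 * x 1 * (\<Sum>i=2..n. (x i)\<^sup>2)) = enat (4 * (n - 1))"
    "srk n 4 (x 0 * x 1 * (\<Sum>i=1..n. (x i)\<^sup>2)) = enat (4 * (n - 1))"
    "srk n 4 (x 0 * x 1 * (\<Sum>i=0..n. (x i)\<^sup>2)) = enat (4 * (n - 1))"
    unfolding nsecant by (rule srk_eq_secant[OF n x_lin dual]; simp)+
  moreover have "infinite {Z. symmetric_decomposition n 4 (x 0 * x 1 * (\<Sum>i=2..n. (x i)\<^sup>2)) Z \<and> card Z = 4 * (n - 1)}"
    "infinite {Z. symmetric_decomposition n 4 (x 0 * x 1 * (\<Sum>i=1..n. (x i)\<^sup>2)) Z \<and> card Z = 4 * (n - 1)}"
    "infinite {Z. symmetric_decomposition n 4 (x 0 * x 1 * (\<Sum>i=0..n. (x i)\<^sup>2)) Z \<and> card Z = 4 * (n - 1)}"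
    unfolding nsecant by (rule infinite_secant_decompositions[OF n x_lin dual]; simp)+
  \<comment> \<open>The value \<open>c = 0\<close> gives the fifth quartic and \<open>c = 1\<close>
    the ninth.\<close>
  moreover have tangent_secant: "enat (4 * (n - 1)) \<le> srk n 4 G \<and> srk n 4 G \<le> enat (4 * (n - 1) + 2)"
    if G: "G = x 0 * x 1 * (x 1 * x 2 + (\<Sum>i=3..n. (x i)\<^sup>2) + scale c ((x 0)\<^sup>2))"
      and c: "3 * c \<noteq> 4 * of_nat (n - 2)" for G c
  proof
    have "dderiv (e i) (scale c ((x 0)\<^sup>2)) = 0" if "i \<in> {2..n}" for i
      using that by (simp add: dderiv_scale dderiv_square dual)
    then have "enat (4 * (n - 1) + 2) \<le> srk n 4 G"
      unfolding G by (rule srk_ge_tangent_secant[OF n dual])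
    then show "enat (4 * (n - 1)) \<le> srk n 4 G"
      by (rule order_trans[rotated]) simp
    show "srk n 4 G \<le> enat (4 * (n - 1) + 2)"
      unfolding G by (rule srk_le_tangent_secant[OF x_lin n c])
  qed
  moreover have "enat (4 * (n - 1)) \<le> srk n 4 (x 0 * x 1 * (x 1 * x 2 + (\<Sum>i=3..n. (x i)\<^sup>2))) \<and>
      srk n 4 (x 0 * x 1 * (x 1 * x 2 + (\<Sum>i=3..n. (x i)\<^sup>2))) \<le> enat (4 * (n - 1) + 2)"
  proof (rule tangent_secant[where c = 0])
    have "(of_nat (n - 2) :: 'k) \<noteq> 0"
      unfolding of_nat_eq_0_iff using n by simp
    then show "3 * 0 \<noteq> (4 * of_nat (n - 2) :: 'k)"
      by (metis mult_eq_0_iff mult_zero_right zero_neq_numeral)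
  qed simp
  moreover have "enat (4 * (n - 1)) \<le> srk n 4 (x 0 * x 1 * ((x 0)\<^sup>2 + x 1 * x 2 + (\<Sum>i=3..n. (x i)\<^sup>2))) \<and>
      srk n 4 (x 0 * x 1 * ((x 0)\<^sup>2 + x 1 * x 2 + (\<Sum>i=3..n. (x i)\<^sup>2))) \<le> enat (4 * (n - 1) + 2)"
  proof (rule tangent_secant[where c = 1])
    \<comment> \<open>An odd number differs from a multiple of 4.\<close>
    have "(of_nat 3 :: 'k) \<noteq> of_nat (4 * (n - 2))"
      unfolding of_nat_eq_iff by presburger
    then show "3 * 1 \<noteq> (4 * of_nat (n - 2) :: 'k)" by simp
  qed (simp add: algebra_simps)
  moreover have secant: "enat (4 * (n - 1)) \<le> srk n 4 (x 0 * (scale l (x 0) + x 1) * ((\<Sum>i=1..n. (x i)\<^sup>2) + scale c ((x 0)\<^sup>2))) \<and>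
      srk n 4 (x 0 * (scale l (x 0) + x 1) * ((\<Sum>i=1..n. (x i)\<^sup>2) + scale c ((x 0)\<^sup>2))) \<le> enat (4 * (n - 1) + 2)" for l c
  proof (rule srk_bounds_secant_mixed[OF n])
    \<comment> \<open>The second hyperplane becomes a coordinate, and \<open>u\<close> is the dual
      basis. Expanding the square of \<open>x 1 = y 1 - l * y 0\<close> gives the coefficients
      \<open>l^2\<close>, \<open>- 2 * l\<close> and 1.\<close>
    define y where "y = (\<lambda>i. if i = 1 then scale l (x 0) + x 1 else x i)"
    define u where "u = (\<lambda>i. if i = 0 then \<lambda>j. e 0 j - l * e 1 j else e i)"
    show "y i \<in> linear_forms n" if "i \<le> n" for i
      using that n by (auto simp: y_def intro!: linear_forms_intros x_lin)
    show "dderiv (u i) (y j) = of_bool (i = j)" if "i \<le> n" "j \<le> n" for i j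
      unfolding const
      by (auto simp: y_def u_def dderiv_add dderiv_scale D e_def scale_const simp flip: single_add)
    have y_sum: "(\<Sum>i=2..n. (y i)\<^sup>2) = (\<Sum>i=2..n. (x i)\<^sup>2)"
      by (rule sum.cong) (auto simp: y_def)
    have y_eqs: "y 0 = x 0" "y 1 = scale l (x 0) + x 1" by (simp_all add: y_def)
    define L where "L = Poly_Mapping.single (0 :: nat \<Rightarrow>\<^sub>0 nat) l"
    have scales: "scale l p = L * p" "scale (- 2 * l) p = - 2 * L * p" "scale (c + l\<^sup>2) p = scale c p + L * L * p" for p
      by (simp_all add: L_def scale_def single_add single_mult_0 single_uminus power2_eq_square distrib_right)
    show "x 0 * (scale l (x 0) + x 1) * ((\<Sum>i=1..n. (x i)\<^sup>2) + scale c ((x 0)\<^sup>2)) =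
        y 0 * y 1 * ((\<Sum>i=2..n. (y i)\<^sup>2) +
          (scale (c + l\<^sup>2) ((y 0)\<^sup>2) + scale (- 2 * l) (y 0 * y 1) + scale 1 ((y 1)\<^sup>2)))"
      unfolding sum1 y_sum y_eqs scale_simps scales by algebra
  qed
  moreover have "enat (4 * (n - 1)) \<le> srk n 4 (x 0 * (scale l (x 0) + x 1) * (\<Sum>i=0..n. (x i)\<^sup>2)) \<and>
      srk n 4 (x 0 * (scale l (x 0) + x 1) * (\<Sum>i=0..n. (x i)\<^sup>2)) \<le> enat (4 * (n - 1) + 2)" for l
    using secant[of l 1] by (simp only: sum0 scale_simps add.commute)
  moreover have "enat (4 * (n - 1)) \<le> srk n 4 (x 0 * (x 0 + x 1) * (\<Sum>i=1..n. (x i)\<^sup>2)) \<and>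
      srk n 4 (x 0 * (x 0 + x 1) * (\<Sum>i=1..n. (x i)\<^sup>2)) \<le> enat (4 * (n - 1) + 2)"
    using secant[of 1 0] by (simp only: scale_simps add_0_right)
  moreover have "enat (4 * (n - 1)) \<le> srk n 4 (x 0 * (scale (- (l\<^sup>2)) (x 0) + x 1 + scale l (x 2)) *
        (x 0 * x 1 + (\<Sum>i=2..n. (x i)\<^sup>2))) \<and>
      srk n 4 (x 0 * (scale (- (l\<^sup>2)) (x 0) + x 1 + scale l (x 2)) *
        (x 0 * x 1 + (\<Sum>i=2..n. (x i)\<^sup>2))) \<le> enat (4 * (n - 1) + 2)" for l
  proof (rule srk_bounds_secant_mixed[OF n])
    \<comment> \<open>Substituting for \<open>x 1\<close> turns \<open>x 0 * x 1\<close> into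
      \<open>y 0 * y 1 + l^2 * y 0^2 - l * y 0 * x 2\<close>. Completing the square with
      \<open>x 2^2\<close> gives \<open>y 2\<close> and leaves \<open>3 / 4 * l^2\<close> at
      \<open>y 0^2\<close>.\<close>
    define y where "y = (\<lambda>i. if i = 1 then scale (- (l\<^sup>2)) (x 0) + x 1 + scale l (x 2)
      else if i = 2 then x 2 - scale (l / 2) (x 0) else x i)"
    define u where "u = (\<lambda>i. if i = 0 then \<lambda>j. e 0 j + l\<^sup>2 / 2 * e 1 j + l / 2 * e 2 j
      else if i = 2 then \<lambda>j. e 2 j - l * e 1 j else e i)"
    show "y i \<in> linear_forms n" if "i \<le> n" for i
      using that n by (auto simp: y_def intro!: linear_forms_intros x_lin)
    show "dderiv (u i) (y j) = of_bool (i = j)" if "i \<le> n" "j \<le> n" for i j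
      unfolding const
      by (auto simp: y_def u_def dderiv_add dderiv_diff dderiv_scale D e_def scale_const
          power2_eq_square simp flip: single_add single_diff)
    have y_eqs: "y 0 = x 0" "y 1 = scale (- (l\<^sup>2)) (x 0) + x 1 + scale l (x 2)" by (simp_all add: y_def)
    have y2: "(\<Sum>i=2..n. (y i)\<^sup>2) = (x 2 - scale (l / 2) (x 0))\<^sup>2 + (\<Sum>i=3..n. (x i)\<^sup>2)"
    proof -
      have "(\<Sum>i=2..n. (y i)\<^sup>2) = (y 2)\<^sup>2 + (\<Sum>i=3..n. (y i)\<^sup>2)"
        using sum.atLeast_Suc_atMost[of 2 n "\<lambda>i. (y i)\<^sup>2"] n by (simp add: numeral_3_eq_3 numeral_2_eq_2)
      moreover have "(\<Sum>i=3..n. (y i)\<^sup>2) = (\<Sum>i=3..n. (x i)\<^sup>2)"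
        by (rule sum.cong) (auto simp: y_def)
      ultimately show ?thesis by (simp add: y_def)
    qed
    define H where "H = Poly_Mapping.single (0 :: nat \<Rightarrow>\<^sub>0 nat) (l / 2)"
    have H: "Poly_Mapping.single 0 l = 2 * H"
      by (simp add: H_def mult_single flip: single_numeral)
    have scales: "scale (l / 2) p = H * p" "scale l p = 2 * H * p" "scale (- (l\<^sup>2)) p = - 4 * H * H * p"
      "scale (3 / 4 * l\<^sup>2) p = 3 * H * H * p" for p
    proof -
      have "3 / 4 * l\<^sup>2 = 3 * (l / 2 * (l / 2))" by (simp add: power2_eq_square)
      then show "scale (3 / 4 * l\<^sup>2) p = 3 * H * H * p"
        by (simp only: scale_def single_mult_0 single_numeral H_def mult.assoc)
    qed (simp_all add: scale_def H single_uminus power2_eq_square single_mult_0 mult_ac, simp add: H_def)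
    show "x 0 * (scale (- (l\<^sup>2)) (x 0) + x 1 + scale l (x 2)) * (x 0 * x 1 + (\<Sum>i=2..n. (x i)\<^sup>2)) =
        y 0 * y 1 * ((\<Sum>i=2..n. (y i)\<^sup>2) +
          (scale (3 / 4 * l\<^sup>2) ((y 0)\<^sup>2) + scale 1 (y 0 * y 1) + scale 0 ((y 1)\<^sup>2)))"
      unfolding sum2 y2 y_eqs scales scale_simps by algebra
  qed
  ultimately show ?thesis by blast
qed

end
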